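(* Let $d\ge 2$. There exists an effective $\mathbb Z^d$-subshift $Y$ such that the problem "$X\subseteq Y$ on SFT inputs $X$" is $\Pi^0_2$-complete.
   Context: For a finite alphabet $\mathcal A$ (a finite subset of $\mathbb N$), a pattern is a function $p\colon S\to\mathcal A$ with $S\subset\mathbb Z^d$ finite; it appears in $x\in\mathcal A^{\mathbb Z^d}$ if there is $u\in\mathbb Z^d$ with $x(u+s)=p(s)$ for all $s\in S$. For a set $\mathcal F$ of patterns, $X_{\mathcal F}$ is the set of configurations in which no pattern from $\mathcal F$ appears. A subshift is a set of the form $X_{\mathcal F}$ (possibly empty); it is an SFT if $\mathcal F$ can be taken finite, and effective if $\mathcal F$ can be taken recursively enumerable. The subshift $Y$ is a fixed parameter. "The problem $X\subseteq Y$ on SFT inputs" is: given a $\mathbb Z^d$-SFT $X$, specified by an alphabet and a finite set of forbidden patterns, determine whether $X\subseteq Y$. Completeness is with respect to many-one reductions. *)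

theory Defs
  imports Main "HOL-Library.FuncSet" "HOL-Library.Nat_Bijection"
begin

section \<open>Partial recursive functions and \<open>\<Pi>\<^sup>0\<^sub>2\<close>\<close>

text \<open>
  Kleene's partial recursive functions. Programs carry no arity: a program defines a partial
  function on argument lists, and it is undefined on lists of an inappropriate length.
\<close>

datatype recf =
    Zero
  | Succ
  | Proj nat
  | Comp recf "recf list"
  | PrimRec recf recf
  | Mu recf

inductive evaluates :: "recf \<Rightarrow> nat list \<Rightarrow> nat \<Rightarrow> bool" where
  Zero: "evaluates Zero xs 0"
| Succ: "evaluates Succ [x] (Suc x)"
| Proj: "i < length xs \<Longrightarrow> evaluates (Proj i) xs (xs ! i)"
| Comp: "list_all2 (\<lambda>g y. evaluates g xs y) gs ys \<Longrightarrow> evaluates f ys z \<Longrightarrow>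
    evaluates (Comp f gs) xs z"
| PrimRec_0: "evaluates f xs y \<Longrightarrow> evaluates (PrimRec f g) (0 # xs) y"
| PrimRec_Suc: "evaluates (PrimRec f g) (n # xs) y \<Longrightarrow> evaluates g (n # y # xs) z \<Longrightarrow>
    evaluates (PrimRec f g) (Suc n # xs) z"
| Mu: "evaluates f (n # xs) 0 \<Longrightarrow> (\<And>m. m < n \<Longrightarrow> \<exists>y>0. evaluates f (m # xs) y) \<Longrightarrow>
    evaluates (Mu f) xs n"

definition total_computable :: "(nat \<Rightarrow> nat) \<Rightarrow> bool" where
  "total_computable f \<longleftrightarrow> (\<exists>r. \<forall>x. evaluates r [x] (f x))"

definition decidable3 :: "(nat \<Rightarrow> nat \<Rightarrow> nat \<Rightarrow> bool) \<Rightarrow> bool" where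
  "decidable3 R \<longleftrightarrow> (\<exists>r. \<forall>x y z. evaluates r [x, y, z] (if R x y z then 1 else 0))"

definition rec_enumerable :: "nat set \<Rightarrow> bool" where
  "rec_enumerable A \<longleftrightarrow> (\<exists>r. A = {x. \<exists>y. evaluates r [x] y})"

definition Pi02 :: "nat set \<Rightarrow> bool" where
  "Pi02 A \<longleftrightarrow> (\<exists>R. decidable3 R \<and> A = {x. \<forall>y. \<exists>z. R x y z})"

definition many_one_reducible :: "nat set \<Rightarrow> nat set \<Rightarrow> bool" where
  "many_one_reducible A B \<longleftrightarrow> (\<exists>f. total_computable f \<and> (\<forall>x. x \<in> A \<longleftrightarrow> f x \<in> B))"

definition Pi02_complete :: "nat set \<Rightarrow> bool" where
  "Pi02_complete A \<longleftrightarrow> Pi02 A \<and> (\<forall>B. Pi02 B \<longrightarrow> many_one_reducible B A)"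


section \<open>Subshifts\<close>

text \<open>
  \<open>\<int>\<^sup>d\<close> is the set of integer lists of length \<open>d\<close>. Configurations are extensional functions, so
  that set inclusion of subshifts, possibly over different alphabets, has its usual meaning.
\<close>

definition int_lattice :: "nat \<Rightarrow> int list set" where
  "int_lattice d = {v. length v = d}"

definition vadd :: "int list \<Rightarrow> int list \<Rightarrow> int list" where
  "vadd u v = map2 (+) u v"

definition configurations :: "nat \<Rightarrow> nat set \<Rightarrow> (int list \<Rightarrow> nat) set" where
  "configurations d A = int_lattice d \<rightarrow>\<^sub>E A"

definition patterns :: "nat \<Rightarrow> nat set \<Rightarrow> (int list \<rightharpoonup> nat) set" where
  "patterns d A = {p. finite (dom p) \<and> dom p \<subseteq> int_lattice d \<and> ran p \<subseteq> A}"

definition appears :: "nat \<Rightarrow> (int list \<rightharpoonup> nat) \<Rightarrow> (int list \<Rightarrow> nat) \<Rightarrow> bool" where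
  "appears d p x \<longleftrightarrow> (\<exists>u\<in>int_lattice d. \<forall>s\<in>dom p. Some (x (vadd u s)) = p s)"

definition subshift_of ::
  "nat \<Rightarrow> nat set \<Rightarrow> (int list \<rightharpoonup> nat) set \<Rightarrow> (int list \<Rightarrow> nat) set" where
  "subshift_of d A F = {x \<in> configurations d A. \<forall>p\<in>F. \<not> appears d p x}"


section \<open>Encodings and the inclusion problem\<close>

text \<open>
  A pattern is presented by a list of its argument-value pairs without repeated arguments; its
  codes are those of all such lists, one for each order of the arguments.
\<close>

type_synonym pattern_list = "(int list \<times> nat) list"

definition pattern_code :: "pattern_list \<Rightarrow> nat" where
  "pattern_code ps =
    list_encode (map (\<lambda>(v, a). prod_encode (list_encode (map int_encode v), a)) ps)"

definition pattern_codes :: "(int list \<rightharpoonup> nat) set \<Rightarrow> nat set" where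
  "pattern_codes F = {pattern_code ps | ps. distinct (map fst ps) \<and> map_of ps \<in> F}"

definition effective_subshift :: "nat \<Rightarrow> (int list \<Rightarrow> nat) set \<Rightarrow> bool" where
  "effective_subshift d Y \<longleftrightarrow>
    (\<exists>A F. finite A \<and> F \<subseteq> patterns d A \<and> rec_enumerable (pattern_codes F) \<and>
       Y = subshift_of d A F)"

definition SFT_input :: "nat \<Rightarrow> nat list \<Rightarrow> pattern_list list \<Rightarrow> bool" where
  "SFT_input d as pss \<longleftrightarrow>
    (\<forall>ps\<in>set pss. distinct (map fst ps) \<and> map_of ps \<in> patterns d (set as))"

definition SFT_of :: "nat \<Rightarrow> nat list \<Rightarrow> pattern_list list \<Rightarrow> (int list \<Rightarrow> nat) set" where
  "SFT_of d as pss = subshift_of d (set as) (map_of ` set pss)"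

definition SFT_code :: "nat list \<Rightarrow> pattern_list list \<Rightarrow> nat" where
  "SFT_code as pss = prod_encode (list_encode as, list_encode (map pattern_code pss))"

text \<open>Numbers that are not codes of well-formed inputs count as negative instances.\<close>

definition SFT_inclusion_problem :: "nat \<Rightarrow> (int list \<Rightarrow> nat) set \<Rightarrow> nat set" where
  "SFT_inclusion_problem d Y =
    {SFT_code as pss | as pss. SFT_input d as pss \<and> SFT_of d as pss \<subseteq> Y}"

end

theory Submission
  imports Defs
begin

text \<open>
  Take \<open>Y\<close> to consist of the configurations in which no symbol \<open>\<beta>\<close> occurs to the right of a
  symbol \<open>\<alpha>\<close> in the same row. A universal predicate \<open>U x y z\<close> yields a \<open>\<Pi>\<^sup>0\<^sub>2\<close>-complete set
  \<open>{x. \<forall>y. \<exists>z. U x y z}\<close>, and a fixed register machine started on \<open>(x, y)\<close> halts iff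
  \<open>\<exists>z. U x y z\<close>. Its space-time diagrams are described
    by local rules over a fixed alphabet: \<open>\<alpha>\<close> marks the corner of
  the diagram, and the distance from \<open>\<alpha>\<close> to \<open>\<beta>\<close> in the bottom row encodes \<open>y\<close>, which the rules leave
  free. The number \<open>x\<close> is imposed by forbidding all but one symbol at distance \<open>x + 1\<close> from \<open>\<alpha>\<close>.
  Hence a configuration of this SFT containing both marks exists iff for some \<open>y\<close> the machine runs
  forever; the configurations that compactness produces from \<open>y \<rightarrow> \<infinity>\<close> lack \<open>\<beta>\<close> and lie in \<open>Y\<close>.

  Conversely, \<open>X \<subseteq> Y\<close> says that each of countably many finite patterns occurs in no configuration
  of \<open>X\<close>, and by compactness each of these conditions has a finite witness.
\<close>

section \<open>Computable functions on encoded data\<close>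

text \<open>A configuration outside \<open>Y\<close> has to certify a statement of the form: some
  \<open>y\<close> makes the machine run forever. A tiling certifies the infinite run directly, but
  an unbounded guess \<open>y\<close> is a difficulty: by compactness, an SFT that allows every
  finite guess also allows the limit where the guess is infinite. That a second mark stands at some
  finite distance is not a closed condition, so no SFT can impose it; it is put into the complement
  of \<open>Y\<close> instead, where it costs only an infinite, easily enumerated family of
  forbidden pairs. The instruction set is dictated by the tiling. A register is an initial segment
  of columns, so \<open>Clear\<close> and \<open>Copy\<close> act in every cell separately, and
  \<open>Inc\<close> and \<open>Dec\<close> compare a cell with one neighbour. A whole machine step
  is then one row further up, and only branching needs global information. The alphabet may depend
  neither on \<open>x\<close> nor on time. Hence the universal relation is compiled once,
  \<open>x\<close> is read off the tiling in unary, and the remaining code, which is part of a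
  symbol, has to range over a finite set.\<close>

lemma evaluates_Comp1:
  "evaluates g xs y \<Longrightarrow> evaluates f [y] z \<Longrightarrow> evaluates (Comp f [g]) xs z"
  by (rule evaluates.Comp[of xs "[g]" "[y]"]) simp_all

lemma evaluates_Comp2:
  "evaluates g xs y \<Longrightarrow> evaluates h xs y' \<Longrightarrow> evaluates f [y, y'] z \<Longrightarrow>
    evaluates (Comp f [g, h]) xs z"
  by (rule evaluates.Comp[of xs "[g, h]" "[y, y']"]) simp_all

lemma evaluates_Comp3:
  "evaluates g xs y \<Longrightarrow> evaluates h xs y' \<Longrightarrow> evaluates k xs y'' \<Longrightarrow>
    evaluates f [y, y', y''] z \<Longrightarrow> evaluates (Comp f [g, h, k]) xs z"
  by (rule evaluates.Comp[of xs "[g, h, k]" "[y, y', y'']"]) simp_all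

lemma evaluates_Proj': "i < length xs \<Longrightarrow> y = xs ! i \<Longrightarrow> evaluates (Proj i) xs y"
  by (auto intro: evaluates.Proj)

section \<open>Programs for arithmetic and pairing\<close>

fun rconst :: "nat \<Rightarrow> recf" where
  "rconst 0 = Zero"
| "rconst (Suc n) = Comp Succ [rconst n]"

lemma evaluates_rconst: "evaluates (rconst n) xs n"
  by (induction n) (auto intro: evaluates.Zero evaluates_Comp1 evaluates.Succ)

definition radd :: recf where
  "radd = PrimRec (Proj 0) (Comp Succ [Proj 1])"

lemma evaluates_radd: "evaluates radd [m, n] (m + n)"
  unfolding radd_def
proof (induction m)
  case 0
  show ?case by (rule evaluates.PrimRec_0) (simp add: evaluates_Proj')
next
  case (Suc m)
  show ?case
    by (rule evaluates.PrimRec_Suc[OF Suc])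
      (rule evaluates_Comp1[OF evaluates_Proj'[where y = "m + n"]], simp_all add: evaluates.Succ)
qed

definition rpred :: recf where
  "rpred = PrimRec Zero (Proj 0)"

lemma evaluates_rpred: "evaluates rpred [n] (n - 1)"
  unfolding rpred_def
proof (induction n)
  case 0
  show ?case by (rule evaluates.PrimRec_0) (simp add: evaluates.Zero)
next
  case (Suc n)
  show ?case by (rule evaluates.PrimRec_Suc[OF Suc]) (simp add: evaluates_Proj')
qed

text \<open>\<open>PrimRec\<close> recurses on its first argument, whereas \<open>rpred\<close> has
  to be iterated as often as the second one says; hence the swap.\<close>

definition rsub :: recf where
  "rsub = Comp (PrimRec (Proj 0) (Comp rpred [Proj 1])) [Proj 1, Proj 0]"

lemma evaluates_rsub: "evaluates rsub [m, n] (m - n)"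
proof -
  have *: "evaluates (PrimRec (Proj 0) (Comp rpred [Proj 1])) [n, m] (m - n)"
  proof (induction n)
    case 0
    show ?case by (rule evaluates.PrimRec_0) (simp add: evaluates_Proj')
  next
    case (Suc n)
    show ?case
      by (rule evaluates.PrimRec_Suc[OF Suc], rule evaluates_Comp1[where y = "m - n"])
        (use evaluates_rpred[of "m - n"] in \<open>simp_all add: evaluates_Proj'\<close>)
  qed
  show ?thesis unfolding rsub_def
    by (rule evaluates_Comp2[OF _ _ *]) (simp_all add: evaluates_Proj')
qed

definition rtriangle :: recf where
  "rtriangle = PrimRec Zero (Comp radd [Comp Succ [Proj 0], Proj 1])"

lemma evaluates_rtriangle: "evaluates rtriangle [n] (triangle n)"
  unfolding rtriangle_def
proof (induction n)
  case 0
  show ?case by (rule evaluates.PrimRec_0) (simp add: evaluates.Zero)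
next
  case (Suc n)
  have "evaluates (Comp radd [Comp Succ [Proj 0], Proj 1]) [n, triangle n] (Suc n + triangle n)"
    by (intro evaluates_Comp2[OF _ _ evaluates_radd] evaluates_Comp1[OF _ evaluates.Succ]
        evaluates_Proj') auto
  then show ?case using evaluates.PrimRec_Suc[OF Suc] by (simp add: add.commute)
qed

definition rpair :: recf where
  "rpair = Comp radd [Comp rtriangle [radd], Proj 0]"

lemma evaluates_rpair: "evaluates rpair [m, n] (prod_encode (m, n))"
  unfolding rpair_def prod_encode_def prod.case
  by (intro evaluates_Comp2[OF _ _ evaluates_radd] evaluates_Comp1[OF evaluates_radd]
      evaluates_rtriangle evaluates_Proj') auto

text \<open>The index of the largest triangular number up to the argument, that is, \<open>m + n\<close> for the
  argument \<open>prod_encode (m, n)\<close>.\<close>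

definition rroot :: recf where
  "rroot = Mu (Comp rsub [Comp Succ [Proj 1], Comp rtriangle [Comp Succ [Proj 0]]])"

text \<open>The code is \<open>triangle (m + n) + m\<close>, which is below
  \<open>triangle (Suc (m + n))\<close> but below no earlier triangular number. The truncated
  difference \<open>Suc c - triangle (Suc s)\<close> vanishes exactly when
  \<open>c < triangle (Suc s)\<close>.\<close>

lemma evaluates_rroot: "evaluates rroot [prod_encode (m, n)] (m + n)"
proof -
  let ?f = "Comp rsub [Comp Succ [Proj 1], Comp rtriangle [Comp Succ [Proj 0]]]"
  have ev: "evaluates ?f [s, c] (Suc c - triangle (Suc s))" for s c
    by (intro evaluates_Comp2[OF _ _ evaluates_rsub] evaluates_Comp1[OF _ evaluates.Succ]
        evaluates_Comp1[OF _ evaluates_rtriangle] evaluates_Proj') auto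
  have mono: "triangle (Suc s) \<le> triangle t" if "s < t" for s t
    using that by (induction t) (auto simp: less_Suc_eq)
  have 0: "evaluates ?f [m + n, prod_encode (m, n)] 0"
    using ev[of "m + n" "prod_encode (m, n)"] by (simp add: prod_encode_def)
  have 1: "\<exists>y>0. evaluates ?f [s, prod_encode (m, n)] y" if "s < m + n" for s
    using ev[of s "prod_encode (m, n)"] mono[OF that]
    by (intro exI[of _ "Suc (prod_encode (m, n)) - triangle (Suc s)"]) (simp add: prod_encode_def)
  show ?thesis
    unfolding rroot_def by (rule evaluates.Mu[OF 0 1])
qed

definition rfst :: recf where
  "rfst = Comp rsub [Proj 0, Comp rtriangle [rroot]]"

lemma prod_encode_0: "prod_encode (0, 0) = 0"
  by (simp add: prod_encode_def)

lemma evaluates_rfst: "evaluates rfst [prod_encode (m, n)] m"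
proof -
  have "evaluates rfst [prod_encode (m, n)] (prod_encode (m, n) - triangle (m + n))"
    unfolding rfst_def
    by (intro evaluates_Comp2[OF _ _ evaluates_rsub] evaluates_Comp1[OF evaluates_rroot]
        evaluates_rtriangle evaluates_Proj') auto
  then show ?thesis by (simp add: prod_encode_def)
qed

definition rsnd :: recf where
  "rsnd = Comp rsub [rroot, rfst]"

lemma evaluates_rsnd: "evaluates rsnd [prod_encode (m, n)] n"
  using evaluates_Comp2[OF evaluates_rroot evaluates_rfst evaluates_rsub, of m n]
  by (simp add: rsnd_def)

text \<open>Recursion on a selector that is 0 or 1. Composition evaluates both branches, so a branch
  may not diverge.\<close>

definition rif :: recf where
  "rif = PrimRec (Proj 1) (Proj 2)"

lemma evaluates_rif: "evaluates rif [of_bool c, a, b] (if c then a else b)"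
proof -
  have 0: "evaluates rif [0, a, b] b"
    unfolding rif_def by (rule evaluates.PrimRec_0) (simp add: evaluates_Proj')
  have "evaluates rif [Suc 0, a, b] a"
    unfolding rif_def
    by (rule evaluates.PrimRec_Suc[OF 0[unfolded rif_def]]) (simp add: evaluates_Proj')
  with 0 show ?thesis by simp
qed


section \<open>Computability of total functions between encoded types\<close>

class encodable =
  fixes enc :: "'a \<Rightarrow> nat"
  assumes enc_eq_iff [simp]: "enc x = enc y \<longleftrightarrow> x = y"

instantiation nat :: encodable
begin
definition "enc_nat (n :: nat) = n"
instance by standard (simp add: enc_nat_def)
end

instantiation int :: encodable
begin
definition "enc_int = int_encode"
instance by standard (simp add: enc_int_def int_encode_eq)
end

instantiation bool :: encodable
begin
definition "enc_bool (b :: bool) = (of_bool b :: nat)"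
instance by standard (simp add: enc_bool_def)
end

instantiation prod :: (encodable, encodable) encodable
begin
definition "enc_prod p = prod_encode (enc (fst p), enc (snd p))"
instance by standard (auto simp: enc_prod_def)
end

instantiation list :: (encodable) encodable
begin
definition "enc_list xs = list_encode (map enc xs)"
instance
proof
  have "inj (enc :: 'a \<Rightarrow> nat)" by (simp add: inj_def)
  then show "enc xs = enc ys \<longleftrightarrow> xs = ys" for xs ys :: "'a list"
    by (simp add: enc_list_def list_encode_eq inj_map_eq_map)
qed
end

lemma enc_Pair: "enc (a, b) = prod_encode (enc a, enc b)"
  by (simp add: enc_prod_def)

lemma enc_Nil: "enc [] = 0"
  by (simp add: enc_list_def)

lemma enc_Cons: "enc (x # xs) = Suc (prod_encode (enc x, enc xs))"
  by (simp add: enc_list_def)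

definition computable :: "('a::encodable \<Rightarrow> 'b::encodable) \<Rightarrow> bool" where
  "computable f \<longleftrightarrow> (\<exists>r. \<forall>x. evaluates r [enc x] (enc (f x)))"

named_theorems computable_intros

lemma computable_id [computable_intros]: "computable (\<lambda>x. x)"
  unfolding computable_def by (intro exI[of _ "Proj 0"]) (auto intro: evaluates_Proj')

lemma computable_const [computable_intros]: "computable (\<lambda>x. c)"
  unfolding computable_def by (intro exI[of _ "rconst (enc c)"]) (auto intro: evaluates_rconst)

lemma computable_comp: "computable f \<Longrightarrow> computable g \<Longrightarrow> computable (\<lambda>x. f (g x))"
  unfolding computable_def by (meson evaluates_Comp1)

lemma computable_Pair [computable_intros]:
  assumes "computable f" "computable g"
  shows "computable (\<lambda>x. (f x, g x))"
  using assms unfolding computable_def enc_Pair by (meson evaluates_Comp2 evaluates_rpair)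

lemma computable_comp2:
  assumes "computable (\<lambda>(a, b). h a b)" "computable f" "computable g"
  shows "computable (\<lambda>x. h (f x) (g x))"
  using computable_comp[OF assms(1) computable_Pair[OF assms(2,3)]] by simp

lemma computable_comp3:
  assumes "computable (\<lambda>(a, b, c). h a b c)" "computable f" "computable g" "computable k"
  shows "computable (\<lambda>x. h (f x) (g x) (k x))"
  using computable_comp[OF assms(1) computable_Pair[OF assms(2) computable_Pair[OF assms(3,4)]]]
  by simp

lemma computable_case_prod [computable_intros]:
  "computable (\<lambda>x. f x (fst (g x)) (snd (g x))) \<Longrightarrow> computable (\<lambda>x. case g x of (a, b) \<Rightarrow> f x a b)"
  by (simp add: split_beta)

lemma computable_of_code:
  assumes "\<And>x. evaluates r [enc (f x)] (enc (h x))" "computable f"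
  shows "computable h"
  using assms unfolding computable_def by (meson evaluates_Comp1)

lemma computable_of_code2:
  assumes "\<And>x. evaluates r [enc (f x), enc (g x)] (enc (h x))" "computable f" "computable g"
  shows "computable h"
  using assms unfolding computable_def by (meson evaluates_Comp2)

lemma computable_fst [computable_intros]: "computable f \<Longrightarrow> computable (\<lambda>x. fst (f x))"
  by (erule computable_of_code[rotated, where r = rfst]) (simp add: enc_prod_def evaluates_rfst)

lemma computable_snd [computable_intros]: "computable f \<Longrightarrow> computable (\<lambda>x. snd (f x))"
  by (erule computable_of_code[rotated, where r = rsnd]) (simp add: enc_prod_def evaluates_rsnd)

lemma computable_Suc [computable_intros]: "computable f \<Longrightarrow> computable (\<lambda>x. Suc (f x))"
  by (erule computable_of_code[rotated, where r = Succ]) (simp add: enc_nat_def evaluates.Succ)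

lemma computable_add [computable_intros]:
  fixes f g :: "_ \<Rightarrow> nat"
  shows "computable f \<Longrightarrow> computable g \<Longrightarrow> computable (\<lambda>x. f x + g x)"
  by (rule computable_of_code2[where r = radd and f = f and g = g])
    (auto simp: enc_nat_def evaluates_radd)

lemma computable_diff [computable_intros]:
  fixes f g :: "_ \<Rightarrow> nat"
  shows "computable f \<Longrightarrow> computable g \<Longrightarrow> computable (\<lambda>x. f x - g x)"
  by (rule computable_of_code2[where r = rsub and f = f and g = g])
    (auto simp: enc_nat_def evaluates_rsub)

lemma computable_enc [computable_intros]: "computable f \<Longrightarrow> computable (\<lambda>x. enc (f x))"
  by (simp add: computable_def enc_nat_def)

lemma computable_if [computable_intros]:
  assumes "computable P" "computable f" "computable g"
  shows "computable (\<lambda>x. if P x then f x else g x)"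
proof -
  obtain p where p: "\<And>x. evaluates p [enc x] (of_bool (P x))"
    using assms(1) by (auto simp: computable_def enc_bool_def)
  obtain r s where "\<And>x. evaluates r [enc x] (enc (f x))" "\<And>x. evaluates s [enc x] (enc (g x))"
    using assms(2,3) by (auto simp: computable_def)
  then have "evaluates (Comp rif [p, r, s]) [enc x] (if P x then enc (f x) else enc (g x))" for x
    using evaluates_Comp3[OF p _ _ evaluates_rif] by blast
  then show ?thesis unfolding computable_def if_distrib[of enc] by blast
qed

lemma computable_not [computable_intros]:
  assumes "computable P"
  shows "computable (\<lambda>x. \<not> P x)"
proof -
  have "(\<lambda>x. \<not> P x) = (\<lambda>x. if P x then False else True)" by auto
  then show ?thesis using assms by (simp only: computable_if computable_const)
qed

lemma computable_conj [computable_intros]: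
  assumes "computable P" "computable Q"
  shows "computable (\<lambda>x. P x \<and> Q x)"
proof -
  have "(\<lambda>x. P x \<and> Q x) = (\<lambda>x. if P x then Q x else False)" by auto
  then show ?thesis using assms by (simp only: computable_if computable_const)
qed

lemma computable_disj [computable_intros]:
  "computable P \<Longrightarrow> computable Q \<Longrightarrow> computable (\<lambda>x. P x \<or> Q x)"
  using computable_not[OF computable_conj[OF computable_not computable_not], of P Q] by simp

lemma computable_imp [computable_intros]:
  "computable P \<Longrightarrow> computable Q \<Longrightarrow> computable (\<lambda>x. P x \<longrightarrow> Q x)"
  unfolding imp_conv_disj by (intro computable_disj computable_not)

lemma computable_eq_0: 
  fixes f :: "_ \<Rightarrow> nat"
  assumes "computable f"
  shows "computable (\<lambda>x. f x = 0)"
proof -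
  have "evaluates (Comp rsub [rconst 1, Proj 0]) [n] (1 - n)" for n
    by (intro evaluates_Comp2[OF evaluates_rconst _ evaluates_rsub] evaluates_Proj') auto
  moreover have "1 - n = enc (n = 0)" for n :: nat
    by (cases n) (auto simp: enc_bool_def)
  ultimately have "evaluates (Comp rsub [rconst 1, Proj 0]) [n] (enc (n = 0))" for n by simp
  then show ?thesis
    by (intro computable_of_code[OF _ assms]) (simp only: enc_nat_def)
qed

lemma computable_le [computable_intros]:
  fixes f g :: "_ \<Rightarrow> nat"
  shows "computable f \<Longrightarrow> computable g \<Longrightarrow> computable (\<lambda>x. f x \<le> g x)"
  using computable_eq_0[OF computable_diff, of f g] by simp

lemma computable_less [computable_intros]:
  fixes f g :: "_ \<Rightarrow> nat"
  shows "computable f \<Longrightarrow> computable g \<Longrightarrow> computable (\<lambda>x. f x < g x)"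
  using computable_not[OF computable_le, of g f] by (simp add: not_le)

lemma computable_eq [computable_intros]:
  assumes "computable f" "computable g"
  shows "computable (\<lambda>x. f x = g x)"
proof -
  have "computable (\<lambda>x. enc (f x) \<le> enc (g x) \<and> enc (g x) \<le> enc (f x))"
    by (intro computable_intros assms)
  moreover have "enc (f x) \<le> enc (g x) \<and> enc (g x) \<le> enc (f x) \<longleftrightarrow> f x = g x" for x
    using enc_eq_iff[of "f x" "g x"] by linarith
  ultimately show ?thesis by simp
qed

text \<open>The bounded quantifier and the recursions over lists below all rest on this closure
  property. All parameters travel as the single code of \<open>x\<close>; \<open>t'\<close>
  rearranges the arguments that \<open>PrimRec\<close> supplies.\<close>

lemma computable_rec_nat [computable_intros]:
  fixes n :: "'a::encodable \<Rightarrow> nat" and a :: "'a \<Rightarrow> 'b::encodable"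
  assumes "computable n" "computable a" "computable (\<lambda>(x, i, b). h x i b)"
  shows "computable (\<lambda>x. rec_nat (a x) (h x) (n x))"
proof -
  obtain s where s: "\<And>x. evaluates s [enc x] (enc (a x))"
    using assms(2) by (auto simp: computable_def)
  obtain t where t: "\<And>x i b. evaluates t [enc (x :: 'a, i :: nat, b :: 'b)] (enc (h x i b))"
    using assms(3) by (force simp: computable_def)
  define t' where "t' = Comp t [Comp rpair [Proj 2, Comp rpair [Proj 0, Proj 1]]]"
  have t': "evaluates t' [i, enc b, enc x] (enc (h x i b))" for i b x
    unfolding t'_def
    by (rule evaluates_Comp1[OF _ t], unfold enc_Pair)
      (intro evaluates_Comp2[OF _ _ evaluates_rpair] evaluates_Proj'; simp add: enc_nat_def)
  have rec: "evaluates (PrimRec s t') [k, enc x] (enc (rec_nat (a x) (h x) k))" for k x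
    by (induction k) (auto intro: evaluates.PrimRec_0 evaluates.PrimRec_Suc s t')
  show ?thesis
    by (rule computable_of_code2[where f = n and g = "\<lambda>x. x" and r = "PrimRec s t'"])
      (auto simp: enc_nat_def rec assms(1) intro: computable_id)
qed

lemma computable_all_less [computable_intros]:
  fixes n :: "'a::encodable \<Rightarrow> nat"
  assumes "computable n" "computable (\<lambda>(x, i). P x i)"
  shows "computable (\<lambda>x. \<forall>i<n x. P x i)"
proof -
  have "computable (\<lambda>x. rec_nat True (\<lambda>i b. b \<and> P x i) (n x))"
    by (intro computable_intros assms(1) computable_comp2[OF assms(2)])
  moreover have "rec_nat True (\<lambda>i b. b \<and> P x i) k \<longleftrightarrow> (\<forall>i<k. P x i)" for x k
    by (induction k) (auto simp: less_Suc_eq)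
  ultimately show ?thesis by simp
qed

section \<open>Lists\<close>

lemma computable_Cons [computable_intros]:
  assumes "computable f" "computable g"
  shows "computable (\<lambda>x. f x # g x)"
  by (rule computable_of_code[OF _ computable_Pair[OF assms], where r = "Comp Succ [Proj 0]"])
    (auto simp: enc_Cons enc_Pair intro!: evaluates_Comp1[OF evaluates_Proj' evaluates.Succ])

lemma computable_tl [computable_intros]:
  assumes "computable (f :: _ \<Rightarrow> 'a::encodable list)"
  shows "computable (\<lambda>x. tl (f x))"
proof -
  have *: "evaluates (Comp rsnd [rpred]) [enc xs] (enc (tl xs))" for xs :: "'a list"
  proof (rule evaluates_Comp1[OF evaluates_rpred])
    show "evaluates rsnd [enc xs - 1] (enc (tl xs))"
      \<comment> \<open>For \<open>[]\<close> the code is 0, its predecessor is 0, and 0 decodes to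
        the pair of zeros, so the result is the code of \<open>tl [] = []\<close>.\<close>
      using evaluates_rsnd[of 0 0]
        by (cases xs) (simp_all add: enc_Nil enc_Cons evaluates_rsnd prod_encode_0)
  qed
  show ?thesis by (rule computable_of_code[OF _ assms]) (rule *)
qed

lemma computable_hd [computable_intros]:
  assumes "computable (f :: _ \<Rightarrow> 'a::encodable list)"
  shows "computable (\<lambda>x. hd (f x))"
proof -
  \<comment> \<open>\<open>hd []\<close> is unspecified but fixed, so its code can be built into the
    program as a constant.\<close>
  define r where "r = Comp rif [Comp rsub [rconst 1, Proj 0], rconst (enc (hd [] :: 'a)), Comp rfst [rpred]]"
  have *: "evaluates r [enc xs] (enc (hd xs))" for xs :: "'a list"
  proof -
    have 1: "evaluates (Comp rsub [rconst 1, Proj 0]) [enc xs] (of_bool (xs = []))"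
      using evaluates_Comp2[OF evaluates_rconst evaluates_Proj' evaluates_rsub, of 0 "[enc xs]"
        "enc xs" 1]
      by (cases xs) (auto simp: enc_Nil enc_Cons)
    have "\<exists>y. evaluates (Comp rfst [rpred]) [enc xs] y \<and> (xs \<noteq> [] \<longrightarrow> y = enc (hd xs))"
    proof (cases xs)
      case Nil
      then show ?thesis
        using evaluates_Comp1[OF evaluates_rpred[of 0]] evaluates_rfst[of 0 0]
        by (auto simp: enc_Nil prod_encode_0)
    next
      case (Cons y ys)
      then show ?thesis
        using evaluates_Comp1[OF evaluates_rpred[of "enc xs"]] evaluates_rfst[of "enc y" "enc ys"]
        by (auto simp: enc_Cons)
    qed
    then obtain y where 2: "evaluates (Comp rfst [rpred]) [enc xs] y" "xs \<noteq> [] \<longrightarrow> y = enc (hd xs)"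
      by blast
    show ?thesis
      using evaluates_Comp3[OF 1 evaluates_rconst 2(1) evaluates_rif, of "enc (hd [] :: 'a)"] 2(2)
      unfolding r_def by (auto split: if_splits)
  qed
  show ?thesis by (rule computable_of_code[OF _ assms]) (rule *)
qed

lemma length_le_enc: "length xs \<le> enc (xs :: 'a::encodable list)"
proof (induction xs)
  case (Cons x xs)
  then show ?case
    using le_prod_encode_2[of "enc xs" "enc x"] by (simp add: enc_Cons)
qed simp

text \<open>The loop runs \<open>enc (l x)\<close> times, a computable bound on the length of the
  list, and idles once the list is used up.\<close>

lemma computable_foldl [computable_intros]:
  assumes "computable l" "computable a" "computable (\<lambda>(x, b, y). f x b y)"
  shows "computable (\<lambda>x. foldl (f x) (a x) (l x))"
proof -
  let ?step = "\<lambda>x p. if fst p = [] then p else (tl (fst p), f x (snd p) (hd (fst p)))"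
  have "computable (\<lambda>x. snd (rec_nat (l x, a x) (\<lambda>_. ?step x) (enc (l x))))"
    by (intro computable_intros assms(1,2) computable_comp3[OF assms(3)])
  moreover have "snd (rec_nat (ys, b) (\<lambda>_. ?step x) n) = foldl (f x) b ys" if "length ys \<le> n"
    for x ys b n
  proof -
    have "rec_nat (ys, b) (\<lambda>_. ?step x) n = (drop n ys, foldl (f x) b (take n ys))" for n
      by (induction n) (auto simp: drop_Suc tl_drop take_Suc_conv_app_nth hd_drop_conv_nth)
    with that show ?thesis by simp
  qed
  ultimately show ?thesis by (simp add: length_le_enc)
qed

lemma computable_rev [computable_intros]:
  assumes "computable l"
  shows "computable (\<lambda>x. rev (l x))"
proof -
  have "computable (\<lambda>x. foldl (\<lambda>ys y. y # ys) [] (l x))"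
    by (intro computable_intros assms)
  moreover have "foldl (\<lambda>ys y. y # ys) zs xs = rev xs @ zs" for xs zs :: "'b list"
    by (induction xs arbitrary: zs) auto
  ultimately show ?thesis by simp
qed

lemma computable_append [computable_intros]:
  assumes "computable l" "computable m"
  shows "computable (\<lambda>x. l x @ m x)"
proof -
  have "computable (\<lambda>x. foldl (\<lambda>ys y. y # ys) (m x) (rev (l x)))"
    by (intro computable_intros assms)
  moreover have "foldl (\<lambda>ys y. y # ys) zs xs = rev xs @ zs" for xs zs :: "'b list"
    by (induction xs arbitrary: zs) auto
  ultimately show ?thesis by simp
qed

lemma computable_map [computable_intros]:
  assumes "computable l" "computable (\<lambda>(x, y). f x y)"
  shows "computable (\<lambda>x. map (f x) (l x))"
proof -
  have "computable (\<lambda>x. rev (foldl (\<lambda>zs y. f x y # zs) [] (l x)))"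
    by (intro computable_intros assms(1) computable_comp2[OF assms(2)])
  moreover have "foldl (\<lambda>zs y. f x y # zs) zs ys = rev (map (f x) ys) @ zs" for x ys zs
    by (induction ys arbitrary: zs) auto
  ultimately show ?thesis by simp
qed

lemma computable_concat [computable_intros]:
  assumes "computable l"
  shows "computable (\<lambda>x. concat (l x))"
proof -
  have "computable (\<lambda>x. foldl (@) [] (l x))"
    by (intro computable_intros assms)
  moreover have "foldl (@) ys yss = ys @ concat yss" for ys :: "'b list" and yss
    by (induction yss arbitrary: ys) auto
  ultimately show ?thesis by simp
qed

lemma computable_length [computable_intros]:
  assumes "computable l"
  shows "computable (\<lambda>x. length (l x))"
proof -
  have "computable (\<lambda>x. foldl (\<lambda>n y. Suc n) 0 (l x))"
    by (intro computable_intros assms)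
  moreover have "foldl (\<lambda>n y. Suc n) k xs = k + length xs" for xs :: "'b list" and k
    by (induction xs arbitrary: k) auto
  ultimately show ?thesis by simp
qed

lemma computable_drop [computable_intros]:
  assumes "computable n" "computable l"
  shows "computable (\<lambda>x. drop (n x) (l x))"
proof -
  have "computable (\<lambda>x. rec_nat (l x) (\<lambda>_. tl) (n x))"
    by (intro computable_intros assms)
  moreover have "rec_nat ys (\<lambda>_. tl) k = drop k ys" for k and ys :: "'b list"
    by (induction k) (auto simp: drop_Suc tl_drop)
  ultimately show ?thesis by simp
qed

lemma computable_Ball_set [computable_intros]:
  assumes "computable l" "computable (\<lambda>(x, y). P x y)"
  shows "computable (\<lambda>x. \<forall>y\<in>set (l x). P x y)"
proof -
  have "computable (\<lambda>x. foldl (\<lambda>b y. b \<and> P x y) True (l x))"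
    by (intro computable_intros assms(1) computable_comp2[OF assms(2)])
  moreover have "foldl (\<lambda>b y. b \<and> P x y) b ys \<longleftrightarrow> b \<and> (\<forall>y\<in>set ys. P x y)" for x b ys
    by (induction ys arbitrary: b) auto
  ultimately show ?thesis by simp
qed

lemma computable_Bex_set [computable_intros]:
  assumes "computable l" "computable (\<lambda>(x, y). P x y)"
  shows "computable (\<lambda>x. \<exists>y\<in>set (l x). P x y)"
proof -
  have "computable (\<lambda>x. \<not> (\<forall>y\<in>set (l x). \<not> P x y))"
    by (intro computable_intros assms(1) computable_comp2[OF assms(2)])
  then show ?thesis by simp
qed

lemma computable_member [computable_intros]:
  assumes "computable f" "computable l"
  shows "computable (\<lambda>x. f x \<in> set (l x))"
proof -
  have "computable (\<lambda>x. \<exists>y\<in>set (l x). f x = y)"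
    by (intro computable_intros assms(2) computable_comp[OF assms(1)])
  then show ?thesis by simp
qed

lemma computable_n_lists [computable_intros]:
  assumes "computable n" "computable l"
  shows "computable (\<lambda>x. List.n_lists (n x) (l x))"
proof -
  have "computable (\<lambda>x. rec_nat [[]] (\<lambda>_ b. concat (map (\<lambda>ys. map (\<lambda>y. y # ys) (l x)) b)) (n x))"
    by (intro computable_intros assms computable_comp[OF assms(2)])
  moreover have "rec_nat [[]] (\<lambda>_ b. concat (map (\<lambda>ys. map (\<lambda>y. y # ys) xs) b)) k = List.n_lists k xs"
    for k and xs :: "'b list"
    by (induction k) auto
  ultimately show ?thesis by simp
qed

section \<open>Parity, integers and vector addition\<close>

lemma computable_even [computable_intros]:
  assumes "computable n"
  shows "computable (\<lambda>x. even (n x :: nat))"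
proof -
  have "computable (\<lambda>x. rec_nat True (\<lambda>_ b. \<not> b) (n x))"
    by (intro computable_intros assms)
  moreover have "rec_nat True (\<lambda>_ b. \<not> b) k = even k" for k
    by (induction k) auto
  ultimately show ?thesis by simp
qed

lemma computable_div2 [computable_intros]:
  assumes "computable n"
  shows "computable (\<lambda>x. (n x :: nat) div 2)"
proof -
  have "computable (\<lambda>x. rec_nat 0 (\<lambda>i h. if even i then h else Suc h) (n x))"
    by (intro computable_intros assms)
  moreover have "rec_nat 0 (\<lambda>i h. if even i then h else Suc h) k = k div 2" for k
    by (induction k) auto
  ultimately show ?thesis by simp
qed

text \<open>Under \<open>int_encode\<close> a natural number \<open>n\<close> has code
  \<open>2 * n\<close> and the integer \<open>- (n + 1)\<close> has code \<open>2 * n + 1\<close>.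
  Sign and absolute value are therefore read off by parity and halving.\<close>

lemma computable_int [computable_intros]:
  assumes "computable f"
  shows "computable (\<lambda>x. int (f x))"
proof (rule computable_of_code[OF _ assms])
  show "evaluates (Comp radd [Proj 0, Proj 0]) [enc (f x)] (enc (int (f x)))" for x
    using evaluates_Comp2[OF _ _ evaluates_radd, of "Proj 0" "[f x]" "f x" "Proj 0" "f x"]
    by (simp add: enc_nat_def enc_int_def int_encode_def sum_encode_def mult_2 evaluates_Proj')
qed

lemma computable_minus_int_Suc [computable_intros]:
  assumes "computable f"
  shows "computable (\<lambda>x. - int (Suc (f x)))"
proof (rule computable_of_code[OF _ assms])
  show "evaluates (Comp Succ [Comp radd [Proj 0, Proj 0]]) [enc (f x)] (enc (- int (Suc (f x))))"
    for x
    using evaluates_Comp1[OF evaluates_Comp2[OF _ _ evaluates_radd] evaluates.Succ,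
      of "Proj 0" "[f x]" "f x" "Proj 0" "f x"]
    by (simp add: enc_nat_def enc_int_def int_encode_def sum_encode_def mult_2 evaluates_Proj')
qed

lemma computable_nat [computable_intros]:
  assumes "computable f"
  shows "computable (\<lambda>x. nat (f x))"
proof -
  have "computable (\<lambda>x. if even (enc (f x)) then enc (f x) div 2 else 0)"
    by (intro computable_intros assms)
  moreover have "(if even (enc i) then enc i div 2 else 0) = nat i" for i :: int
    by (auto simp: enc_int_def int_encode_def sum_encode_def)
  ultimately show ?thesis by simp
qed

lemma computable_nat_minus [computable_intros]:
  assumes "computable f"
  shows "computable (\<lambda>x. nat (- f x))"
proof -
  have "computable (\<lambda>x. if even (enc (f x)) then 0 else Suc (enc (f x) div 2))"
    by (intro computable_intros assms)
  moreover have "(if even (enc i) then 0 else Suc (enc i div 2)) = nat (- i)" for i :: int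
    by (auto simp: enc_int_def int_encode_def sum_encode_def)
  ultimately show ?thesis by simp
qed

lemma computable_add_int [computable_intros]:
  fixes f g :: "_ \<Rightarrow> int"
  assumes "computable f" "computable g"
  shows "computable (\<lambda>x. f x + g x)"
proof -
  let ?p = "\<lambda>x. nat (f x) + nat (g x)" and ?n = "\<lambda>x. nat (- f x) + nat (- g x)"
  have "computable (\<lambda>x. if ?n x \<le> ?p x then int (?p x - ?n x) else - int (Suc (?n x - ?p x - 1)))"
    by (intro computable_intros assms)
  moreover have "(if ?n x \<le> ?p x then int (?p x - ?n x) else - int (Suc (?n x - ?p x - 1))) = f x + g x" for x
    by auto
  ultimately show ?thesis by simp
qed

lemma computable_vadd [computable_intros]:
  assumes "computable f" "computable g"
  shows "computable (\<lambda>x. vadd (f x) (g x))"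
proof -
  \<comment> \<open>The test for \<open>[]\<close> reproduces the truncation that
    \<open>map2\<close> performs on lists of different lengths.\<close>
  let ?step = "\<lambda>p a. (tl (fst p), if fst p = [] then snd p else (a + hd (fst p)) # snd p)"
  have "computable (\<lambda>x. rev (snd (foldl ?step (g x, []) (f x))))"
    by (intro computable_intros assms)
  moreover have "foldl ?step (v, acc) u = (drop (length u) v, rev (vadd u v) @ acc)" for u v acc
  proof (induction u arbitrary: v acc)
    case (Cons a u)
    then show ?case by (cases v) (auto simp: vadd_def)
  qed (simp add: vadd_def)
  ultimately show ?thesis by simp
qed

section \<open>Decoding\<close>

lemma surj_enc_nat: "surj (enc :: nat \<Rightarrow> nat)"
  by (auto simp: surj_def enc_nat_def)

lemma surj_enc_int: "surj (enc :: int \<Rightarrow> nat)"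
  unfolding enc_int_def by (rule surj_int_encode)

lemma surj_enc_prod:
  assumes "surj (enc :: 'a::encodable \<Rightarrow> nat)" "surj (enc :: 'b::encodable \<Rightarrow> nat)"
  shows "surj (enc :: 'a \<times> 'b \<Rightarrow> nat)"
proof (rule surjI)
  show "enc (map_prod (inv enc) (inv enc) (prod_decode n) :: 'a \<times> 'b) = n" for n
    by (cases "prod_decode n")
      (simp add: enc_Pair surj_f_inv_f[OF assms(1)] surj_f_inv_f[OF assms(2)] flip: prod_decode_eq)
qed

lemma surj_enc_list:
  assumes "surj (enc :: 'a::encodable \<Rightarrow> nat)"
  shows "surj (enc :: 'a list \<Rightarrow> nat)"
proof (rule surjI)
  show "enc (map (inv enc) (list_decode n) :: 'a list) = n" for n
    by (simp add: enc_list_def comp_def surj_f_inv_f[OF assms])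
qed

text \<open>Decoding changes the type but not the number: when every number is a code, the program
  is a projection.\<close>

lemma computable_inv_enc:
  assumes "surj (enc :: 'a::encodable \<Rightarrow> nat)" "computable f"
  shows "computable (\<lambda>x. inv enc (f x) :: 'a)"
proof (rule computable_of_code[OF _ assms(2)])
  show "evaluates (Proj 0) [enc (f x)] (enc (inv enc (f x) :: 'a))" for x
    by (rule evaluates_Proj') (simp_all add: surj_f_inv_f[OF assms(1)] enc_nat_def)
qed

lemma total_computable_iff: "total_computable f \<longleftrightarrow> computable f"
  by (simp add: total_computable_def computable_def enc_nat_def)

lemma decidable3I:
  assumes "computable (\<lambda>(x, y, z). R x y z)"
  shows "decidable3 R"
proof -
  obtain r where r: "\<And>x y z. evaluates r [enc (x, y, z)] (enc (R x y z))"
    using assms by (force simp: computable_def)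
  let ?r = "Comp r [Comp rpair [Proj 0, Comp rpair [Proj 1, Proj 2]]]"
  have "evaluates ?r [x, y, z] (enc (R x y z))" for x y z
    by (rule evaluates_Comp1[OF _ r], unfold enc_Pair)
      (intro evaluates_Comp2[OF _ _ evaluates_rpair] evaluates_Proj'; simp add: enc_nat_def)
  then have "evaluates ?r [x, y, z] (if R x y z then 1 else 0)" for x y z
    by (simp only: enc_bool_def of_bool_def)
  then show ?thesis unfolding decidable3_def by blast
qed

section \<open>Determinism and recursive enumerability\<close>

inductive_cases evaluates_ZeroE: "evaluates Zero xs y"
inductive_cases evaluates_SuccE: "evaluates Succ xs y"
inductive_cases evaluates_ProjE: "evaluates (Proj i) xs y"
inductive_cases evaluates_CompE: "evaluates (Comp f gs) xs y"
inductive_cases evaluates_PrimRec_0E: "evaluates (PrimRec f g) (0 # xs) y"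
inductive_cases evaluates_PrimRec_SucE: "evaluates (PrimRec f g) (Suc n # xs) y"
inductive_cases evaluates_MuE: "evaluates (Mu f) xs y"

lemma evaluates_deterministic:
  "evaluates r xs y \<Longrightarrow> evaluates r xs y' \<Longrightarrow> y' = y"
proof (induction r xs y arbitrary: y' rule: evaluates.induct)
  case (Zero xs)
  then show ?case by (rule evaluates_ZeroE)
next
  case (Succ x)
  then show ?case by (rule evaluates_SuccE) simp
next
  case (Proj i xs)
  from Proj.prems show ?case by (rule evaluates_ProjE)
next
  case (PrimRec_0 f xs y g)
  from PrimRec_0.prems have "evaluates f xs y'" by (rule evaluates_PrimRec_0E)
  then show ?case by (rule PrimRec_0.IH)
next
  case (Comp xs gs ys f z)
  from Comp.prems obtain ys' where ys': "list_all2 (\<lambda>g y. evaluates g xs y) gs ys'"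
    "evaluates f ys' y'"
    by (auto elim: evaluates_CompE)
  have "ys' = ys"
    using Comp.IH(1) Comp.hyps ys'(1) by (auto simp: list_all2_conv_all_nth intro!: nth_equalityI)
  with ys'(2) Comp.IH(2) show ?case by blast
next
  case (PrimRec_Suc f g n xs y z)
  from PrimRec_Suc.prems obtain y2 where "evaluates (PrimRec f g) (n # xs) y2"
    "evaluates g (n # y2 # xs) y'"
    by (auto elim: evaluates_PrimRec_SucE)
  with PrimRec_Suc.IH show ?case by blast
next
  case (Mu f n xs)
  from Mu.prems have y': "evaluates f (y' # xs) 0" "\<And>m. m < y' \<Longrightarrow> \<exists>y>0. evaluates f (m # xs) y"
    by (auto elim: evaluates_MuE)
  show ?case
  proof (rule ccontr)
    assume "y' \<noteq> n"
    then consider "y' < n" | "n < y'" by linarith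
    then show False
    proof cases
      case 1
      with Mu.IH(2) y'(1) show False by blast
    next
      case 2
      with y'(2) Mu.IH(1) show False by blast
    qed
  qed
qed

text \<open>The domain of an unbounded search is recursively enumerable. \<open>Mu\<close> looks for
  the value 0, so it is applied to the negation of \<open>Q\<close>.\<close>

lemma rec_enumerable_exI:
  fixes Q :: "nat \<Rightarrow> nat \<Rightarrow> bool"
  assumes "computable (\<lambda>(x, y). Q x y)"
  shows "rec_enumerable {x. \<exists>y. Q x y}"
proof -
  have "computable (\<lambda>(x, y). \<not> Q x y)"
    by (intro computable_intros computable_comp2[OF assms])
  then obtain r where r: "\<And>x y. evaluates r [enc (x, y)] (enc (\<not> Q x y))"
    by (force simp: computable_def)
  define s where "s = Comp r [Comp rpair [Proj 1, Proj 0]]"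
  have s: "evaluates s [y, x] (of_bool (\<not> Q x y))" for x y
    unfolding s_def enc_bool_def[symmetric]
    by (rule evaluates_Comp1[OF _ r], unfold enc_Pair)
      (intro evaluates_Comp2[OF _ _ evaluates_rpair] evaluates_Proj'; simp add: enc_nat_def)
  have "(\<exists>y. Q x y) \<longleftrightarrow> (\<exists>y. evaluates (Mu s) [x] y)" for x
  proof
    assume "\<exists>y. Q x y"
    then have "evaluates (Mu s) [x] (LEAST y. Q x y)"
      using s LeastI_ex[of "Q x"] not_less_Least[of _ "Q x"]
      by (intro evaluates.Mu) (metis of_bool_eq(1), metis of_bool_eq(2) zero_less_one)
    then show "\<exists>y. evaluates (Mu s) [x] y" by blast
  next
    assume "\<exists>y. evaluates (Mu s) [x] y"
    then obtain y where "evaluates s [y, x] 0"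
      by (auto elim: evaluates_MuE)
    from evaluates_deterministic[OF s this] show "\<exists>y. Q x y"
      by (auto simp: of_bool_def split: if_splits)
  qed
  then show ?thesis unfolding rec_enumerable_def by blast
qed


section \<open>A universal relation\<close>

primrec rcode :: "recf \<Rightarrow> nat" where
  "rcode Zero = enc (0 :: nat, 0 :: nat)"
| "rcode Succ = enc (1 :: nat, 0 :: nat)"
| "rcode (Proj i) = enc (2 :: nat, i)"
| "rcode (Comp f gs) = enc (3 :: nat, enc (rcode f, map rcode gs))"
| "rcode (PrimRec f g) = enc (4 :: nat, enc (rcode f, rcode g))"
| "rcode (Mu f) = enc (5 :: nat, rcode f)"

type_synonym judgement = "nat \<times> nat list \<times> nat"

text \<open>The judgement \<open>(e, xs, y)\<close> claims that the program with code \<open>e\<close> has value \<open>y\<close> on \<open>xs\<close>;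
  it is justified by \<open>D\<close> if an introduction rule of \<^const>\<open>evaluates\<close> derives it from members
  of \<open>D\<close>. Lists are accessed by \<open>hd (drop j xs)\<close>, as \<open>xs ! j\<close> is unspecified out of range.\<close>

definition justified :: "judgement list \<Rightarrow> judgement \<Rightarrow> bool" where
  "justified D t \<longleftrightarrow>
    (let e = fst t; xs = fst (snd t); y = snd (snd t);
         k = fst (inv enc e :: nat \<times> nat); b = snd (inv enc e :: nat \<times> nat) in
      k = 0 \<and> y = 0 \<or>
      k = 1 \<and> xs = [hd xs] \<and> y = Suc (hd xs) \<or>
      k = 2 \<and> b < length xs \<and> y = hd (drop b xs) \<or>
      k = 3 \<and> (let f = fst (inv enc b :: nat \<times> nat list); gs = snd (inv enc b :: nat \<times> nat list) in
        (\<exists>s\<in>set D. fst s = f \<and> snd (snd s) = y \<and> length (fst (snd s)) = length gs \<and>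
          (\<forall>j<length gs. (hd (drop j gs), xs, hd (drop j (fst (snd s)))) \<in> set D))) \<or>
      k = 4 \<and> (let f = fst (inv enc b :: nat \<times> nat); g = snd (inv enc b :: nat \<times> nat) in
        xs \<noteq> [] \<and>
        (if hd xs = 0 then (f, tl xs, y) \<in> set D
         else (\<exists>s\<in>set D. fst s = e \<and> fst (snd s) = (hd xs - 1) # tl xs \<and>
           (g, (hd xs - 1) # snd (snd s) # tl xs, y) \<in> set D))) \<or>
      k = 5 \<and> (b, y # xs, 0) \<in> set D \<and>
        (\<forall>m<y. \<exists>s\<in>set D. fst s = b \<and> fst (snd s) = m # xs \<and> 0 < snd (snd s)))"

lemma inv_enc_enc [simp]: "inv enc (enc x) = x"
  by (simp add: inv_f_f inj_def)

lemma computable_justified [computable_intros]: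
  assumes "computable D" "computable t"
  shows "computable (\<lambda>x. justified (D x) (t x))"
  unfolding justified_def Let_def
  by (intro computable_intros computable_inv_enc surj_enc_prod surj_enc_list surj_enc_nat
      computable_comp[OF assms(1)] computable_comp[OF assms(2)])

lemma justified_mono:
  assumes "justified D t" "set D \<subseteq> set D'"
  shows "justified D' t"
  using assms(1) unfolding justified_def Let_def if_bool_eq_conj
  by (elim disj_forward conj_forward) (use assms(2) in \<open>blast+\<close>)

lemma justified_simps:
  "justified D (rcode Zero, xs, y) \<longleftrightarrow> y = 0"
  "justified D (rcode Succ, xs, y) \<longleftrightarrow> xs = [hd xs] \<and> y = Suc (hd xs)"
  "justified D (rcode (Proj i), xs, y) \<longleftrightarrow> i < length xs \<and> y = hd (drop i xs)"
  "justified D (rcode (Comp f gs), xs, y) \<longleftrightarrow>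
    (\<exists>s\<in>set D. fst s = rcode f \<and> snd (snd s) = y \<and> length (fst (snd s)) = length gs \<and>
      (\<forall>j<length gs. (hd (drop j (map rcode gs)), xs, hd (drop j (fst (snd s)))) \<in> set D))"
  "justified D (rcode (PrimRec f g), xs, y) \<longleftrightarrow> xs \<noteq> [] \<and>
    (if hd xs = 0 then (rcode f, tl xs, y) \<in> set D
     else (\<exists>s\<in>set D. fst s = rcode (PrimRec f g) \<and> fst (snd s) = (hd xs - 1) # tl xs \<and>
       (rcode g, (hd xs - 1) # snd (snd s) # tl xs, y) \<in> set D))"
  "justified D (rcode (Mu f), xs, y) \<longleftrightarrow> (rcode f, y # xs, 0) \<in> set D \<and>
    (\<forall>m<y. \<exists>s\<in>set D. fst s = rcode f \<and> fst (snd s) = m # xs \<and> 0 < snd (snd s))"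
  by (simp_all add: justified_def Let_def)

text \<open>Entries are justified by later entries, so a new conclusion is put in front and
  soundness is an induction over the list.\<close>

primrec derivation :: "judgement list \<Rightarrow> bool" where
  "derivation [] \<longleftrightarrow> True"
| "derivation (t # D) \<longleftrightarrow> justified D t \<and> derivation D"

lemma computable_derivation [computable_intros]:
  assumes "computable D"
  shows "computable (\<lambda>x. derivation (D x))"
proof -
  have "computable (\<lambda>x. \<forall>i<length (D x). justified (drop (Suc i) (D x)) (hd (drop i (D x))))"
    by (intro computable_intros computable_comp[OF assms])
  moreover have "derivation E \<longleftrightarrow> (\<forall>i<length E. justified (drop (Suc i) E) (hd (drop i E)))" for E
    by (induction E) (auto simp: All_less_Suc2)
  ultimately show ?thesis by simp
qed

lemma derivation_append: "derivation D \<Longrightarrow> derivation E \<Longrightarrow> derivation (D @ E)"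
  by (induction D) (auto intro: justified_mono)

lemma derivation_sound:
  "derivation D \<Longrightarrow> (rcode r, xs, y) \<in> set D \<Longrightarrow> evaluates r xs y"
proof (induction D arbitrary: r xs y)
  case (Cons t D)
  show ?case
  proof (cases "(rcode r, xs, y) \<in> set D")
    case True
    with Cons show ?thesis by simp
  next
    case False
    with Cons.prems have j: "justified D (rcode r, xs, y)" and "derivation D" by auto
    then have IH: "\<And>r xs y. (rcode r, xs, y) \<in> set D \<Longrightarrow> evaluates r xs y"
      using Cons.IH by blast
    show ?thesis
    proof (cases r)
      case Zero
      with j show ?thesis by (auto simp: justified_simps intro: evaluates.Zero simp del: rcode.simps)
    next
      case Succ
      with j show ?thesis
        using evaluates.Succ[of "hd xs"] by (simp add: justified_simps del: rcode.simps)
    next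
      case (Proj i)
      with j show ?thesis
        by (auto simp: justified_simps hd_drop_conv_nth intro: evaluates.Proj simp del: rcode.simps)
    next
      case (Comp f gs)
      from j obtain ys where ys: "(rcode f, ys, y) \<in> set D" "length ys = length gs"
        "\<And>j. j < length gs \<Longrightarrow> (hd (drop j (map rcode gs)), xs, hd (drop j ys)) \<in> set D"
        unfolding Comp justified_simps by force
      then have "list_all2 (\<lambda>g y. evaluates g xs y) gs ys"
        by (auto simp: list_all2_conv_all_nth hd_drop_conv_nth intro!: IH)
      with IH[OF ys(1)] show ?thesis unfolding Comp by (rule evaluates.Comp[rotated])
    next
      case (PrimRec f g)
      show ?thesis
      proof (cases "hd xs")
        case 0
        with j have "xs = 0 # tl xs" "(rcode f, tl xs, y) \<in> set D"
          unfolding PrimRec justified_simps by (metis hd_Cons_tl, simp)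
        then show ?thesis unfolding PrimRec by (metis IH evaluates.PrimRec_0)
      next
        case (Suc n)
        with j have "xs = Suc n # tl xs"
          unfolding PrimRec justified_simps by (metis hd_Cons_tl)
        moreover from j Suc obtain z where "(rcode (PrimRec f g), n # tl xs, z) \<in> set D"
          "(rcode g, n # z # tl xs, y) \<in> set D"
          unfolding PrimRec justified_simps by force
        ultimately show ?thesis
          unfolding PrimRec by (metis IH evaluates.PrimRec_Suc)
      qed
    next
      case (Mu f)
      with j show ?thesis unfolding Mu justified_simps
        by (intro evaluates.Mu) (auto intro: IH, metis IH prod.collapse)
    qed
  qed
qed simp

text \<open>\<open>Comp\<close> and \<open>Mu\<close> have any finite number of premises; their
  derivations are concatenated.\<close>

lemma derivation_finite_union:
  fixes n :: nat
  assumes "\<And>j. j < n \<Longrightarrow> \<exists>D. derivation D \<and> t j \<in> set D"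
  shows "\<exists>D. derivation D \<and> (\<forall>j<n. t j \<in> set D)"
  using assms
proof (induction n)
  case (Suc n)
  then obtain D E where "derivation D" "\<forall>j<n. t j \<in> set D" "derivation E" "t n \<in> set E"
    by (meson less_Suc_eq)
  then show ?case
    by (intro exI[of _ "D @ E"]) (auto simp: derivation_append less_Suc_eq)
qed (auto intro: exI[of _ "[]"])

lemma derivation_complete:
  assumes "evaluates r xs y"
  shows "\<exists>D. derivation D \<and> (rcode r, xs, y) \<in> set D"
proof -
  have step: "\<exists>D. derivation D \<and> t \<in> set D" if "derivation D" "justified D t" for D t
    using that by (intro exI[of _ "t # D"]) auto
  show ?thesis
    using assms
  proof (induction r xs y rule: evaluates.induct)
    case (Zero xs)
    show ?case by (rule step[of "[]"]) (auto simp: justified_simps simp del: rcode.simps)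
  next
    case (Succ x)
    show ?case by (rule step[of "[]"]) (auto simp: justified_simps simp del: rcode.simps)
  next
    case (Proj i xs)
    then show ?case
      by (intro step[of "[]"]) (auto simp: justified_simps hd_drop_conv_nth simp del: rcode.simps)
  next
    case (Comp xs gs ys f z)
    have "\<exists>D. derivation D \<and> (rcode (gs ! j), xs, ys ! j) \<in> set D" if "j < length gs" for j
      using Comp.IH(1) that by (auto simp: list_all2_conv_all_nth)
    then obtain D where D: "derivation D" "\<forall>j<length gs. (rcode (gs ! j), xs, ys ! j) \<in> set D"
      using derivation_finite_union[of "length gs" "\<lambda>j. (rcode (gs ! j), xs, ys ! j)"] by blast
    from Comp.IH(2) obtain E where E: "derivation E" "(rcode f, ys, z) \<in> set E" by blast
    have "length ys = length gs" using Comp.IH(1) by (auto dest: list_all2_lengthD)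
    with D E show ?case
      by (intro step[of "D @ E"], simp add: derivation_append, unfold justified_simps,
          intro bexI[of _ "(rcode f, ys, z)"]) (auto simp: hd_drop_conv_nth)
  next
    case (PrimRec_0 f xs y g)
    then show ?case by (auto intro!: step simp: justified_simps simp del: rcode.simps)
  next
    case (PrimRec_Suc f g n xs y z)
    then obtain D E where "derivation D" "(rcode (PrimRec f g), n # xs, y) \<in> set D"
      "derivation E" "(rcode g, n # y # xs, z) \<in> set E" by blast
    then show ?case
      by (intro step[of "D @ E"], simp add: derivation_append, unfold justified_simps)
        (auto intro!: bexI[of _ "(rcode (PrimRec f g), n # xs, y)"] simp del: rcode.simps)
  next
    case (Mu f n xs)
    \<comment> \<open>The rule for \<open>Mu\<close> only asserts that some positive value exists at
      each smaller argument. Choosing these values turns the premises into concrete judgements that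
      can be collected in one list.\<close>
    from Mu.IH(2) obtain v where v:
      "\<And>m. m < n \<Longrightarrow> v m > 0 \<and> (\<exists>D. derivation D \<and> (rcode f, m # xs, v m) \<in> set D)"
      by metis
    then obtain D where D: "derivation D" "\<forall>m<n. (rcode f, m # xs, v m) \<in> set D"
      using derivation_finite_union[of n "\<lambda>m. (rcode f, m # xs, v m)"] by blast
    from Mu.IH(1) obtain E where E: "derivation E" "(rcode f, n # xs, 0) \<in> set E" by blast
    have "\<exists>s\<in>set (D @ E). fst s = rcode f \<and> fst (snd s) = m # xs \<and> 0 < snd (snd s)" if "m < n" for m
      using D(2) v that by (intro bexI[of _ "(rcode f, m # xs, v m)"]) auto
    with D E show ?case
      by (intro step[of "D @ E"], simp add: derivation_append, unfold justified_simps) auto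
  qed
qed

text \<open>A form of Kleene's T predicate. \<open>x\<close> pairs a program code with its
  parameter, and \<open>z\<close> pairs a candidate with a derivation that the program accepts it.
  Checking a given derivation is computable, although evaluation is not.\<close>

definition universal :: "nat \<Rightarrow> nat \<Rightarrow> nat \<Rightarrow> bool" where
  "universal x y z \<longleftrightarrow>
    (let p = inv enc x :: nat \<times> nat; q = inv enc z :: nat \<times> judgement list in
      derivation (snd q) \<and> (fst p, [snd p, y, fst q], 1) \<in> set (snd q))"

lemma computable_universal [computable_intros]:
  assumes "computable f" "computable g" "computable h"
  shows "computable (\<lambda>x. universal (f x) (g x) (h x))"
  unfolding universal_def Let_def
  by (intro computable_intros computable_inv_enc surj_enc_prod surj_enc_list surj_enc_nat assms)

lemma Pi02_reduces_to_universal: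
  assumes "Pi02 B"
  shows "many_one_reducible B {x. \<forall>y. \<exists>z. universal x y z}"
proof -
  from assms obtain R r where B: "B = {x. \<forall>y. \<exists>z. R x y z}"
    and r: "\<And>x y z. evaluates r [x, y, z] (if R x y z then 1 else 0)"
    by (auto simp: Pi02_def decidable3_def)
  have ex: "(\<exists>z. universal (enc (rcode r, x)) y z) \<longleftrightarrow> (\<exists>z. R x y z)" for x y
  proof
    assume "\<exists>z. universal (enc (rcode r, x)) y z"
    then obtain z where "evaluates r [x, y, z] 1"
      by (auto simp: universal_def Let_def dest: derivation_sound)
    from evaluates_deterministic[OF this r] show "\<exists>z. R x y z" by (auto split: if_splits)
  next
    assume "\<exists>z. R x y z"
    then obtain z where "evaluates r [x, y, z] 1" using r by (metis (full_types))
    then obtain D where "derivation D" "(rcode r, [x, y, z], 1) \<in> set D"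
      using derivation_complete by blast
    then have "universal (enc (rcode r, x)) y (enc (z, D))"
      by (simp add: universal_def)
    then show "\<exists>z. universal (enc (rcode r, x)) y z" ..
  qed
  have "total_computable (\<lambda>x. enc (rcode r, x))"
    unfolding total_computable_iff by (intro computable_intros)
  then show ?thesis
    unfolding many_one_reducible_def B using ex by (intro exI[of _ "\<lambda>x. enc (rcode r, x)"]) simp
qed


section \<open>Register machines\<close>

datatype com = Clear nat | Copy nat nat | Inc nat | Dec nat | While nat "com list"

fun next_code :: "com list \<Rightarrow> (nat \<Rightarrow> bool) \<Rightarrow> com list" where
  "next_code [] nonzero = []"
| "next_code (While r cs # K) nonzero = (if nonzero r then cs @ While r cs # K else K)"
| "next_code (c # K) nonzero = K"

fun next_regs :: "com list \<Rightarrow> (nat \<Rightarrow> nat) \<Rightarrow> nat \<Rightarrow> nat" where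
  "next_regs (Clear i # K) \<sigma> = \<sigma>(i := 0)"
| "next_regs (Copy i j # K) \<sigma> = \<sigma>(i := \<sigma> j)"
| "next_regs (Inc i # K) \<sigma> = \<sigma>(i := Suc (\<sigma> i))"
| "next_regs (Dec i # K) \<sigma> = \<sigma>(i := \<sigma> i - 1)"
| "next_regs K \<sigma> = \<sigma>"

definition step :: "com list \<times> (nat \<Rightarrow> nat) \<Rightarrow> com list \<times> (nat \<Rightarrow> nat)" where
  "step s = (next_code (fst s) (\<lambda>r. snd s r > 0), next_regs (fst s) (snd s))"

text \<open>A step inspects only the first command. Quantifying over the continuation
  \<open>K\<close> lets runs be chained inside any surrounding program, loop bodies
  included.\<close>

definition exec :: "com list \<Rightarrow> (nat \<Rightarrow> nat) \<Rightarrow> (nat \<Rightarrow> nat) \<Rightarrow> bool" where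
  "exec cs \<sigma> \<tau> \<longleftrightarrow> (\<forall>K. \<exists>n. (step ^^ n) (cs @ K, \<sigma>) = (K, \<tau>))"

lemma exec_Nil: "exec [] \<sigma> \<sigma>"
  unfolding exec_def by (auto intro: exI[of _ 0])

lemma exec_append:
  assumes "exec cs \<sigma> \<tau>" "exec ds \<tau> \<upsilon>"
  shows "exec (cs @ ds) \<sigma> \<upsilon>"
  unfolding exec_def
proof
  fix K
  obtain m n where "(step ^^ m) (cs @ ds @ K, \<sigma>) = (ds @ K, \<tau>)" "(step ^^ n) (ds @ K, \<tau>) = (K, \<upsilon>)"
    using assms unfolding exec_def by metis
  then have "(step ^^ (n + m)) ((cs @ ds) @ K, \<sigma>) = (K, \<upsilon>)"
    by (simp add: funpow_add)
  then show "\<exists>n. (step ^^ n) ((cs @ ds) @ K, \<sigma>) = (K, \<upsilon>)" ..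
qed

lemma exec_stepI:
  assumes "\<And>K. step (cs @ K, \<sigma>) = (ds @ K, \<tau>)" "exec ds \<tau> \<upsilon>"
  shows "exec cs \<sigma> \<upsilon>"
  unfolding exec_def
proof
  fix K
  obtain n where "(step ^^ n) (ds @ K, \<tau>) = (K, \<upsilon>)"
    using assms(2) unfolding exec_def by metis
  then have "(step ^^ Suc n) (cs @ K, \<sigma>) = (K, \<upsilon>)"
    by (simp only: funpow_Suc_right o_apply assms(1))
  then show "\<exists>n. (step ^^ n) (cs @ K, \<sigma>) = (K, \<upsilon>)" ..
qed

lemma exec_basic:
  "exec cs (\<sigma>(i := 0)) \<tau> \<Longrightarrow> exec (Clear i # cs) \<sigma> \<tau>"
  "exec cs (\<sigma>(i := \<sigma> j)) \<tau> \<Longrightarrow> exec (Copy i j # cs) \<sigma> \<tau>"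
  "exec cs (\<sigma>(i := Suc (\<sigma> i))) \<tau> \<Longrightarrow> exec (Inc i # cs) \<sigma> \<tau>"
  "exec cs (\<sigma>(i := \<sigma> i - 1)) \<tau> \<Longrightarrow> exec (Dec i # cs) \<sigma> \<tau>"
  "\<sigma> r = 0 \<Longrightarrow> exec [While r cs] \<sigma> \<sigma>"
  "\<sigma> r > 0 \<Longrightarrow> exec (cs @ [While r cs]) \<sigma> \<tau> \<Longrightarrow> exec [While r cs] \<sigma> \<tau>"
  by (erule exec_stepI[rotated], simp add: step_def)+
    (rule exec_stepI[OF _ exec_Nil], simp add: step_def, erule exec_stepI[rotated], simp add: step_def)

section \<open>Compilation of partial recursive functions\<close>

text \<open>The registers above \<open>b\<close> are scratch space; they need not be zero initially.\<close>

definition implements :: "com list \<Rightarrow> recf \<Rightarrow> nat list \<Rightarrow> nat \<Rightarrow> bool" where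
  "implements cs r ins b \<longleftrightarrow> (\<forall>\<sigma> y. evaluates r (map \<sigma> ins) y \<longrightarrow>
    (\<exists>\<tau>. exec cs \<sigma> \<tau> \<and> \<tau> b = y \<and> (\<forall>i<b. \<tau> i = \<sigma> i)))"

lemma implementsE:
  assumes "implements cs r ins b" "evaluates r (map \<sigma> ins) y"
  obtains \<tau> where "exec cs \<sigma> \<tau>" "\<tau> b = y" "\<And>i. i < b \<Longrightarrow> \<tau> i = \<sigma> i"
  using assms unfolding implements_def by blast

text \<open>The results are stacked in consecutive registers. Each further program is compiled with
  a larger base, so it leaves both the inputs and the earlier results intact.\<close>

lemma implements_many:
  assumes "\<And>g ins b. g \<in> set gs \<Longrightarrow> \<forall>i\<in>set ins. i < b \<Longrightarrow> \<exists>cs. implements cs g ins b"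
    and "\<forall>i\<in>set ins. i < b"
  shows "\<exists>cs. \<forall>\<sigma> ys. list_all2 (\<lambda>g y. evaluates g (map \<sigma> ins) y) gs ys \<longrightarrow>
    (\<exists>\<tau>. exec cs \<sigma> \<tau> \<and> map \<tau> [b..<b + length gs] = ys \<and> (\<forall>i<b. \<tau> i = \<sigma> i))"
  using assms
proof (induction gs arbitrary: b)
  case Nil
  then show ?case by (auto intro!: exI[of _ "[]"] exec_Nil)
next
  case (Cons g gs)
  obtain c where c: "implements c g ins b"
    using Cons.prems by (meson list.set_intros(1))
  have "\<exists>cs. \<forall>\<sigma> ys. list_all2 (\<lambda>g y. evaluates g (map \<sigma> ins) y) gs ys \<longrightarrow>
    (\<exists>\<tau>. exec cs \<sigma> \<tau> \<and> map \<tau> [Suc b..<Suc b + length gs] = ys \<and> (\<forall>i<Suc b. \<tau> i = \<sigma> i))"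
    using Cons.prems by (intro Cons.IH) (auto simp: less_Suc_eq)
  then obtain cs where cs: "\<And>\<sigma> ys. list_all2 (\<lambda>g y. evaluates g (map \<sigma> ins) y) gs ys \<Longrightarrow>
    \<exists>\<tau>. exec cs \<sigma> \<tau> \<and> map \<tau> [Suc b..<Suc b + length gs] = ys \<and> (\<forall>i<Suc b. \<tau> i = \<sigma> i)"
    by blast
  show ?case
  proof (intro exI[of _ "c @ cs"] allI impI)
    fix \<sigma> zs
    assume "list_all2 (\<lambda>g y. evaluates g (map \<sigma> ins) y) (g # gs) zs"
    then obtain y ys where zs: "zs = y # ys" and y: "evaluates g (map \<sigma> ins) y"
      and ys: "list_all2 (\<lambda>g y. evaluates g (map \<sigma> ins) y) gs ys"
      by (auto simp: list_all2_Cons1)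
    from implementsE[OF c y] obtain \<tau> where \<tau>: "exec c \<sigma> \<tau>" "\<tau> b = y" "\<And>i. i < b \<Longrightarrow> \<tau> i = \<sigma> i"
      by blast
    then have "map \<tau> ins = map \<sigma> ins" using Cons.prems(2) by auto
    with ys cs obtain \<upsilon> where \<upsilon>: "exec cs \<tau> \<upsilon>" "map \<upsilon> [Suc b..<Suc b + length gs] = ys"
      "\<And>i. i < Suc b \<Longrightarrow> \<upsilon> i = \<tau> i"
      by metis
    have "map \<upsilon> [b..<b + length (g # gs)] = zs"
      using \<upsilon>(2) \<upsilon>(3)[of b] \<tau>(2) zs by (simp add: upt_rec)
    with exec_append[OF \<tau>(1) \<upsilon>(1)] \<upsilon>(3) \<tau>(3)
    show "\<exists>\<tau>. exec (c @ cs) \<sigma> \<tau> \<and> map \<tau> [b..<b + length (g # gs)] = zs \<and> (\<forall>i<b. \<tau> i = \<sigma> i)"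
      by (intro exI[of _ \<upsilon>]) auto
  qed
qed

text \<open>The derivation at \<open>n\<close> passes through all smaller indices, so the compiled
  loop meets no undefined intermediate value.\<close>

lemma evaluates_PrimRec_le:
  "evaluates (PrimRec f g) (n # xs) y \<Longrightarrow> k \<le> n \<Longrightarrow> \<exists>v. evaluates (PrimRec f g) (k # xs) v"
proof (induction n arbitrary: y)
  case (Suc n)
  from Suc.prems(1) obtain v where "evaluates (PrimRec f g) (n # xs) v"
    by (rule evaluates_PrimRec_SucE)
  with Suc show ?case by (auto simp: le_Suc_eq)
qed auto

text \<open>Register \<open>b\<close> holds the accumulated value, \<open>b + 1\<close> its index
  and \<open>b + 2\<close> the number of remaining rounds. The invariant \<open>loop\<close> says
  that index plus rounds is the recursion argument and that \<open>b\<close> is the value at the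
  index.\<close>

lemma implements_PrimRec:
  assumes f: "implements cf f ins (b + 3)"
    and g: "implements cg g (Suc b # b # ins) (b + 3)"
    and ins: "\<forall>i\<in>set ins. i < b" "i0 < b"
  shows "implements
    (cf @ [Copy b (b + 3), Clear (b + 1), Copy (b + 2) i0,
      While (b + 2) (cg @ [Copy b (b + 3), Inc (b + 1), Dec (b + 2)])])
    (PrimRec f g) (i0 # ins) b"
  unfolding implements_def
proof (intro allI impI)
  let ?W = "While (b + 2) (cg @ [Copy b (b + 3), Inc (b + 1), Dec (b + 2)])"
  fix \<sigma> y
  assume "evaluates (PrimRec f g) (map \<sigma> (i0 # ins)) y"
  then have y: "evaluates (PrimRec f g) (\<sigma> i0 # map \<sigma> ins) y" by simp
  have loop: "\<exists>\<upsilon>. exec [?W] \<tau> \<upsilon> \<and> \<upsilon> b = y \<and> (\<forall>i<b. \<upsilon> i = \<tau> i)"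
    if "\<tau> (b + 2) = m" "\<tau> (Suc b) + m = \<sigma> i0" "\<And>i. i < b \<Longrightarrow> \<tau> i = \<sigma> i"
      "evaluates (PrimRec f g) (\<tau> (Suc b) # map \<sigma> ins) (\<tau> b)" for \<tau> m
    using that
  proof (induction m arbitrary: \<tau>)
    case 0
    then have "\<tau> b = y" using evaluates_deterministic[OF y] by simp
    with 0 show ?case by (intro exI[of _ \<tau>]) (auto intro!: exec_basic)
  next
    case (Suc m)
    let ?k = "\<tau> (Suc b)"
    obtain v where v: "evaluates (PrimRec f g) (Suc ?k # map \<sigma> ins) v"
      using evaluates_PrimRec_le[OF y, of "Suc ?k"] Suc.prems(2) by auto
    then have "evaluates g (?k # \<tau> b # map \<sigma> ins) v"
      using evaluates_deterministic[OF Suc.prems(4)] by (auto elim: evaluates_PrimRec_SucE)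
    moreover have "map \<tau> ins = map \<sigma> ins" using ins Suc.prems(3) by auto
    ultimately have "evaluates g (map \<tau> (Suc b # b # ins)) v" by (simp only: list.map)
    from implementsE[OF g this] obtain \<tau>' where
      \<tau>': "exec cg \<tau> \<tau>'" "\<tau>' (b + 3) = v" "\<And>i. i < b + 3 \<Longrightarrow> \<tau>' i = \<tau> i" by blast
    define \<tau>'' where "\<tau>'' = \<tau>'(b := v, b + 1 := Suc ?k, b + 2 := m)"
    have *: "exec (cg @ [Copy b (b + 3), Inc (b + 1), Dec (b + 2)]) \<tau> \<tau>''"
    proof (rule exec_append[OF \<tau>'(1)])
      have "\<tau>'' = \<tau>'(b := \<tau>' (b + 3), b + 1 := Suc (\<tau>' (b + 1)), b + 2 := \<tau>' (b + 2) - 1)"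
        using \<tau>' Suc.prems(1) by (simp add: \<tau>''_def)
      then show "exec [Copy b (b + 3), Inc (b + 1), Dec (b + 2)] \<tau>' \<tau>''"
        using exec_Nil by (intro exec_basic) simp
    qed
    have "\<exists>\<upsilon>. exec [?W] \<tau>'' \<upsilon> \<and> \<upsilon> b = y \<and> (\<forall>i<b. \<upsilon> i = \<tau>'' i)"
      by (rule Suc.IH) (use Suc.prems \<tau>' v in \<open>auto simp: \<tau>''_def\<close>)
    then obtain \<upsilon> where "exec [?W] \<tau>'' \<upsilon>" "\<upsilon> b = y" "\<forall>i<b. \<upsilon> i = \<tau>'' i" by blast
    with exec_append[OF *] Suc.prems(1) \<tau>'(3) show ?case
      by (intro exI[of _ \<upsilon>] conjI exec_basic(6)) (simp_all add: \<tau>''_def)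
  qed
  obtain v where v: "evaluates (PrimRec f g) (0 # map \<sigma> ins) v"
    using evaluates_PrimRec_le[OF y, of 0] by auto
  then have "evaluates f (map \<sigma> ins) v" by (rule evaluates_PrimRec_0E)
  from implementsE[OF f this] obtain \<tau> where
    \<tau>: "exec cf \<sigma> \<tau>" "\<tau> (b + 3) = v" "\<And>i. i < b + 3 \<Longrightarrow> \<tau> i = \<sigma> i" by blast
  define \<tau>' where "\<tau>' = \<tau>(b := v, b + 1 := 0, b + 2 := \<sigma> i0)"
  have "\<exists>\<upsilon>. exec [?W] \<tau>' \<upsilon> \<and> \<upsilon> b = y \<and> (\<forall>i<b. \<upsilon> i = \<tau>' i)"
    by (rule loop) (use v \<tau> in \<open>auto simp: \<tau>'_def\<close>)
  then obtain \<upsilon> where \<upsilon>: "exec [?W] \<tau>' \<upsilon>" "\<upsilon> b = y" "\<forall>i<b. \<upsilon> i = \<tau>' i" by blast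
  have "exec [Copy b (b + 3), Clear (b + 1), Copy (b + 2) i0, ?W] \<tau> \<upsilon>"
    using \<upsilon>(1) \<tau> ins(2) by (intro exec_basic(1,2)) (simp add: \<tau>'_def)
  with \<tau> \<upsilon> show "\<exists>\<tau>. exec (cf @ [Copy b (b + 3), Clear (b + 1), Copy (b + 2) i0, ?W]) \<sigma> \<tau> \<and>
      \<tau> b = y \<and> (\<forall>i<b. \<tau> i = \<sigma> i)"
    by (intro exI[of _ \<upsilon>]) (auto intro: exec_append simp: \<tau>'_def)
qed

text \<open>Register \<open>b\<close> runs through the candidates and \<open>Suc b\<close> receives
  the value of \<open>f\<close> there, so the loop stops at the first zero.\<close>

lemma implements_Mu:
  assumes f: "implements cf f (b # ins) (Suc b)"
    and ins: "\<forall>i\<in>set ins. i < b"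
  shows "implements (Clear b # cf @ [While (Suc b) (Inc b # cf)]) (Mu f) ins b"
  unfolding implements_def
proof (intro allI impI)
  let ?W = "While (Suc b) (Inc b # cf)"
  fix \<sigma> y
  assume "evaluates (Mu f) (map \<sigma> ins) y"
  then have y: "evaluates f (y # map \<sigma> ins) 0"
    "\<And>m. m < y \<Longrightarrow> \<exists>v>0. evaluates f (m # map \<sigma> ins) v"
    by (auto elim: evaluates_MuE)
  have loop: "\<exists>\<upsilon>. exec (cf @ [?W]) \<tau> \<upsilon> \<and> \<upsilon> b = y \<and> (\<forall>i<b. \<upsilon> i = \<tau> i)"
    if "\<tau> b + k = y" "\<And>i. i < b \<Longrightarrow> \<tau> i = \<sigma> i" for \<tau> k
    using that
  proof (induction k arbitrary: \<tau>)
    case (0 \<tau>)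
    have "map \<tau> ins = map \<sigma> ins" using ins 0(2) by auto
    with 0(1) y(1) have "evaluates f (map \<tau> (b # ins)) 0" by (simp only: list.map add_0_right)
    from implementsE[OF f this] obtain \<upsilon> where
      "exec cf \<tau> \<upsilon>" "\<upsilon> (Suc b) = 0" "\<And>i. i < Suc b \<Longrightarrow> \<upsilon> i = \<tau> i" by blast
    with 0 show ?case by (intro exI[of _ \<upsilon>]) (auto intro: exec_append exec_basic)
  next
    case (Suc k \<tau>)
    have *: "map \<tau> ins = map \<sigma> ins" using ins Suc.prems(2) by auto
    obtain v where "0 < v" "evaluates f (\<tau> b # map \<sigma> ins) v"
      using y(2)[of "\<tau> b"] Suc.prems(1) by auto
    then have "0 < v" "evaluates f (map \<tau> (b # ins)) v" by (simp_all only: list.map *)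
    from implementsE[OF f this(2)] \<open>0 < v\<close> obtain \<tau>' where
      \<tau>': "exec cf \<tau> \<tau>'" "\<tau>' (Suc b) > 0" "\<And>i. i < Suc b \<Longrightarrow> \<tau>' i = \<tau> i" by blast
    have "\<exists>\<upsilon>. exec (cf @ [?W]) (\<tau>'(b := Suc (\<tau>' b))) \<upsilon> \<and> \<upsilon> b = y \<and>
        (\<forall>i<b. \<upsilon> i = (\<tau>'(b := Suc (\<tau>' b))) i)"
      by (rule Suc.IH) (use Suc.prems \<tau>' in auto)
    then obtain \<upsilon> where \<upsilon>: "exec (cf @ [?W]) (\<tau>'(b := Suc (\<tau>' b))) \<upsilon>" "\<upsilon> b = y"
      "\<forall>i<b. \<upsilon> i = (\<tau>'(b := Suc (\<tau>' b))) i" by blast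
    have "exec [?W] \<tau>' \<upsilon>"
      using \<tau>'(2) \<upsilon>(1) by (intro exec_basic(6)) (auto intro: exec_basic)
    with \<tau>' \<upsilon> show ?case
      by (intro exI[of _ \<upsilon>]) (auto intro: exec_append)
  qed
  obtain \<upsilon> where "exec (cf @ [?W]) (\<sigma>(b := 0)) \<upsilon>" "\<upsilon> b = y" "\<forall>i<b. \<upsilon> i = (\<sigma>(b := 0)) i"
    using loop[of "\<sigma>(b := 0)" y] by auto
  then show "\<exists>\<tau>. exec (Clear b # cf @ [?W]) \<sigma> \<tau> \<and> \<tau> b = y \<and> (\<forall>i<b. \<tau> i = \<sigma> i)"
    by (intro exI[of _ \<upsilon>]) (auto intro: exec_basic)
qed

lemma implements_exists: "\<forall>i\<in>set ins. i < b \<Longrightarrow> \<exists>cs. implements cs r ins b"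
proof (induction r arbitrary: ins b)
  case Zero
  have "implements [Clear b] Zero ins b"
    unfolding implements_def
    by (auto elim!: evaluates_ZeroE intro!: exec_basic exec_Nil exI[of _ "_(b := 0)"])
  then show ?case ..
next
  case Succ
  have "implements [Copy b (hd ins), Inc b] Succ ins b"
    unfolding implements_def
  proof (intro allI impI)
    fix \<sigma> y
    assume "evaluates Succ (map \<sigma> ins) y"
    then obtain i where i: "ins = [i]" "y = Suc (\<sigma> i)" by (auto elim: evaluates_SuccE)
    have "exec [Copy b i, Inc b] \<sigma> (\<sigma>(b := \<sigma> i, b := Suc ((\<sigma>(b := \<sigma> i)) b)))"
      by (intro exec_basic exec_Nil)
    with i show "\<exists>\<tau>. exec [Copy b (hd ins), Inc b] \<sigma> \<tau> \<and> \<tau> b = y \<and> (\<forall>i<b. \<tau> i = \<sigma> i)"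
      by auto
  qed
  then show ?case ..
next
  case (Proj i)
  have "implements [Copy b (ins ! i)] (Proj i) ins b"
    unfolding implements_def
    by (auto elim!: evaluates_ProjE intro!: exec_basic exec_Nil exI[of _ "_(b := _)"])
  then show ?case ..
next
  case (Comp f gs)
  define l where "l = b + length gs"
  obtain c where c: "implements c f [b..<l] l"
    using Comp.IH(1)[of "[b..<l]" l] by auto
  obtain cs where cs: "\<And>\<sigma> ys. list_all2 (\<lambda>g y. evaluates g (map \<sigma> ins) y) gs ys \<Longrightarrow>
    \<exists>\<tau>. exec cs \<sigma> \<tau> \<and> map \<tau> [b..<l] = ys \<and> (\<forall>i<b. \<tau> i = \<sigma> i)"
    using implements_many[of gs ins b] Comp.IH(2) Comp.prems unfolding l_def by metis
  have "implements (cs @ c @ [Copy b l]) (Comp f gs) ins b"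
    unfolding implements_def
  proof (intro allI impI)
    fix \<sigma> y
    assume "evaluates (Comp f gs) (map \<sigma> ins) y"
    then obtain ys where ys: "list_all2 (\<lambda>g y. evaluates g (map \<sigma> ins) y) gs ys" "evaluates f ys y"
      by (rule evaluates_CompE)
    from cs[OF ys(1)] obtain \<tau> where \<tau>: "exec cs \<sigma> \<tau>" "map \<tau> [b..<l] = ys" "\<forall>i<b. \<tau> i = \<sigma> i"
      by blast
    with ys(2) have "evaluates f (map \<tau> [b..<l]) y" by simp
    from implementsE[OF c this] obtain \<upsilon> where
      \<upsilon>: "exec c \<tau> \<upsilon>" "\<upsilon> l = y" "\<And>i. i < l \<Longrightarrow> \<upsilon> i = \<tau> i" by blast
    have "exec (cs @ c @ [Copy b l]) \<sigma> (\<upsilon>(b := \<upsilon> l))"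
      by (intro exec_append[OF \<tau>(1)] exec_append[OF \<upsilon>(1)] exec_basic exec_Nil)
    with \<tau> \<upsilon> show "\<exists>\<tau>. exec (cs @ c @ [Copy b l]) \<sigma> \<tau> \<and> \<tau> b = y \<and> (\<forall>i<b. \<tau> i = \<sigma> i)"
      by (intro exI[of _ "\<upsilon>(b := \<upsilon> l)"]) (auto simp: l_def)
  qed
  then show ?case ..
next
  case (PrimRec f g)
  show ?case
  proof (cases ins)
    case Nil
    \<comment> \<open>No rule evaluates \<open>PrimRec\<close> on an empty argument list, so the
      claim is vacuous.\<close>
    then have "implements [] (PrimRec f g) ins b"
      unfolding implements_def by (auto elim: evaluates.cases)
    then show ?thesis ..
  next
    case (Cons i0 js)
    have "\<exists>cf. implements cf f js (b + 3)" "\<exists>cg. implements cg g (Suc b # b # js) (b + 3)"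
      using PrimRec.prems Cons by (intro PrimRec.IH; fastforce)+
    then show ?thesis
      using implements_PrimRec[of _ f js b _ g i0] PrimRec.prems Cons by auto
  qed
next
  case (Mu f)
  have "\<exists>cf. implements cf f (b # ins) (Suc b)"
    using Mu.prems by (intro Mu.IH) (auto simp: less_Suc_eq)
  then show ?case using implements_Mu Mu.prems by blast
qed

lemma funpow_step_Nil: "fst s = [] \<Longrightarrow> fst ((step ^^ n) s) = []"
  by (induction n) (auto simp: step_def)

text \<open>\<open>implements\<close> says nothing about divergent computations, so non-halting is
  shown by hand. The tested function is total, so every round ends; if no \<open>z\<close> exists,
  the loop head recurs at arbitrarily late times, whereas empty code would persist forever.\<close>

lemma search_program_exists:
  assumes R: "computable (\<lambda>(x, y, z). R x y z)"
  shows "\<exists>P. \<forall>\<sigma>. (\<exists>n. fst ((step ^^ n) (P, \<sigma>)) = []) \<longleftrightarrow> (\<exists>z. R (\<sigma> 0 :: nat) (\<sigma> 1 :: nat) (z :: nat))"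
proof -
  have "computable (\<lambda>(z, x, y). \<not> R x y z)"
    by (intro computable_intros computable_comp3[OF R])
  then obtain r where r: "\<And>x y z. evaluates r [enc (z, x, y)] (enc (\<not> R x y z))"
    by (force simp: computable_def)
  define s where "s = Comp r [Comp rpair [Proj 0, Comp rpair [Proj 1, Proj 2]]]"
  have s: "evaluates s [z, x, y] (of_bool (\<not> R x y z))" for x y z
    unfolding s_def enc_bool_def[symmetric]
    by (rule evaluates_Comp1[OF _ r], unfold enc_Pair)
      (intro evaluates_Comp2[OF _ _ evaluates_rpair] evaluates_Proj'; simp add: enc_nat_def)
  obtain cf where cf: "implements cf s [2, 0, 1] 3"
    using implements_exists[of "[2, 0, 1]" 3 s] by auto
  let ?W = "While 3 (Inc 2 # cf)"
  define P where "P = Clear 2 # cf @ [?W]"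
  have P: "implements P (Mu s) [0, 1] 2"
    using implements_Mu[of cf s 2 "[0, 1]"] cf by (simp add: P_def numeral_eq_Suc)
  show ?thesis
  proof (intro exI[of _ P] allI iffI)
    fix \<sigma> :: "nat \<Rightarrow> nat"
    assume *: "\<exists>z. R (\<sigma> 0) (\<sigma> 1) z"
    have "evaluates (Mu s) (map \<sigma> [0, 1]) (LEAST z. R (\<sigma> 0) (\<sigma> 1) z)"
    proof (rule evaluates.Mu)
      show "evaluates s ((LEAST z. R (\<sigma> 0) (\<sigma> 1) z) # map \<sigma> [0, 1]) 0"
        using s[of "LEAST z. R (\<sigma> 0) (\<sigma> 1) z" "\<sigma> 0" "\<sigma> 1"] LeastI_ex[OF *] by simp
      show "\<exists>v>0. evaluates s (m # map \<sigma> [0, 1]) v" if "m < (LEAST z. R (\<sigma> 0) (\<sigma> 1) z)" for m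
        using s[of m "\<sigma> 0" "\<sigma> 1"] not_less_Least[OF that] by auto
    qed
    from implementsE[OF P this] obtain \<tau> where "exec P \<sigma> \<tau>" by blast
    then show "\<exists>n. fst ((step ^^ n) (P, \<sigma>)) = []"
      unfolding exec_def by (metis append_Nil2 fst_conv)
  next
    fix \<sigma> :: "nat \<Rightarrow> nat"
    assume "\<exists>n. fst ((step ^^ n) (P, \<sigma>)) = []"
    then obtain n where n: "fst ((step ^^ n) (P, \<sigma>)) = []" ..
    show "\<exists>z. R (\<sigma> 0) (\<sigma> 1) z"
    proof (rule ccontr)
      assume none: "\<nexists>z. R (\<sigma> 0) (\<sigma> 1) z"
      have run_cf: "\<exists>\<upsilon>. exec cf \<tau> \<upsilon> \<and> \<upsilon> 0 = \<sigma> 0 \<and> \<upsilon> 1 = \<sigma> 1 \<and> \<upsilon> 3 = 1"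
        if "\<tau> 0 = \<sigma> 0" "\<tau> 1 = \<sigma> 1" for \<tau>
      proof -
        have "evaluates s (map \<tau> [2, 0, 1]) 1"
          using s[of "\<tau> 2" "\<sigma> 0" "\<sigma> 1"] none that by simp
        from implementsE[OF cf this] that show ?thesis
          by (metis zero_less_numeral one_less_numeral_iff semiring_norm(77))
      qed
      have "\<exists>m\<ge>k. \<exists>\<tau>. (step ^^ m) (P, \<sigma>) = ([?W], \<tau>) \<and> \<tau> 0 = \<sigma> 0 \<and> \<tau> 1 = \<sigma> 1 \<and> \<tau> 3 = 1" for k
      proof (induction k)
        case 0
        obtain \<upsilon> where \<upsilon>: "exec cf (\<sigma>(2 := 0)) \<upsilon>" "\<upsilon> 0 = \<sigma> 0" "\<upsilon> 1 = \<sigma> 1" "\<upsilon> 3 = 1"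
          using run_cf[of "\<sigma>(2 := 0)"] by auto
        have "exec (Clear 2 # cf) \<sigma> \<upsilon>" by (intro exec_basic \<upsilon>)
        then obtain m where "(step ^^ m) ((Clear 2 # cf) @ [?W], \<sigma>) = ([?W], \<upsilon>)"
          unfolding exec_def by blast
        with \<upsilon> show ?case unfolding P_def by auto
      next
        case (Suc k)
        then obtain m \<tau> where m: "m \<ge> k" "(step ^^ m) (P, \<sigma>) = ([?W], \<tau>)" "\<tau> 0 = \<sigma> 0" "\<tau> 1 = \<sigma> 1"
          "\<tau> 3 = 1"
          by blast
        obtain \<upsilon> where \<upsilon>: "exec cf (\<tau>(2 := Suc (\<tau> 2))) \<upsilon>" "\<upsilon> 0 = \<sigma> 0" "\<upsilon> 1 = \<sigma> 1" "\<upsilon> 3 = 1"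
          using run_cf[of "\<tau>(2 := Suc (\<tau> 2))"] m by auto
        have "exec (Inc 2 # cf) \<tau> \<upsilon>" by (intro exec_basic \<upsilon>)
        then obtain l where "(step ^^ l) ((Inc 2 # cf) @ [?W], \<tau>) = ([?W], \<upsilon>)"
          unfolding exec_def by blast
        moreover have "step ([?W], \<tau>) = ((Inc 2 # cf) @ [?W], \<tau>)" using m(5) by (simp add: step_def)
        ultimately have "(step ^^ (l + Suc m)) (P, \<sigma>) = ([?W], \<upsilon>)"
          using m(2) by (simp only: funpow_add[of l] funpow.simps(2) o_apply)
        with \<upsilon> m(1) show ?case by (intro exI[of _ "l + Suc m"]) auto
      qed
      then obtain m \<tau> where "m \<ge> n" "(step ^^ m) (P, \<sigma>) = ([?W], \<tau>)" by blast
      then show False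
        using funpow_step_Nil[OF n, of "m - n"]
          by (simp flip: funpow_add o_apply[of "step ^^ _" "step ^^ _"])
    qed
  qed
qed

text \<open>Code is part of a tile, so only finitely many continuations may arise. In
  \<open>?closed S K\<close>, the set \<open>S\<close> collects the continuations met until control
  leaves for \<open>K\<close>. A loop body exits into the loop itself, which adds just one more
  continuation.\<close>

lemma finite_continuations:
  "\<exists>S. finite S \<and> P \<in> S \<and> (\<forall>K\<in>S. \<forall>nonzero. next_code K nonzero \<in> S)"
proof -
  let ?closed = "\<lambda>S K. finite S \<and> (\<forall>K'\<in>S. \<forall>nonzero. next_code K' nonzero \<in> insert K S)"
  have list: "\<exists>S. cs @ K \<in> insert K S \<and> ?closed S K"
    if "\<And>c K. c \<in> set cs \<Longrightarrow> \<exists>S. c # K \<in> S \<and> ?closed S K" for cs K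
    using that
  proof (induction cs)
    case Nil
    show ?case by (intro exI[of _ "{}"]) simp
  next
    case (Cons c cs)
    obtain S where S: "cs @ K \<in> insert K S" "?closed S K" using Cons by auto
    obtain T where T: "c # cs @ K \<in> T" "?closed T (cs @ K)" using Cons.prems[of c "cs @ K"] by auto
    show ?case
    proof (intro exI[of _ "S \<union> T"] conjI ballI allI)
      show "next_code K' nonzero \<in> insert K (S \<union> T)" if "K' \<in> S \<union> T" for K' nonzero
      proof (cases "K' \<in> S")
        case True
        with S(2) show ?thesis by auto
      next
        case False
        with that T(2) have "next_code K' nonzero \<in> insert (cs @ K) T" by auto
        with S(1) show ?thesis by auto
      qed
    qed (use S T in simp_all)
  qed
  have com: "\<exists>S. c # K \<in> S \<and> ?closed S K" for c K
  proof (induction c arbitrary: K)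
    case (While r cs)
    obtain S where "cs @ While r cs # K \<in> insert (While r cs # K) S" "?closed S (While r cs # K)"
      using list[of cs "While r cs # K"] While by blast
    then show ?case by (intro exI[of _ "insert (While r cs # K) S"]) auto
  qed (rule exI[of _ "{_ # _}"], force)+
  obtain S where "P \<in> insert [] S" "?closed S []" using list[of P "[]"] com by auto
  then show ?thesis by (intro exI[of _ "insert [] S"]) auto
qed

primrec regs :: "com \<Rightarrow> nat set" where
  "regs (Clear i) = {i}"
| "regs (Copy i j) = {i, j}"
| "regs (Inc i) = {i}"
| "regs (Dec i) = {i}"
| "regs (While i cs) = insert i (\<Union>(set (map regs cs)))"

lemma finite_regs: "finite (regs c)"
  by (induction c) auto

lemma regs_next_code: "\<Union>(regs ` set (next_code K nonzero)) \<subseteq> \<Union>(regs ` set K)"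
  by (induction K nonzero rule: next_code.induct) auto


section \<open>Space-time diagrams\<close>

datatype symbol = Blank | Alpha | Gamma1 | Delta | Gamma2 | Beta | Gamma3 | Wall
  | Cell "com list" "nat set"

text \<open>\<open>UNIV\<close> on \<open>Wall\<close> acts as a full column to the left of column
  0: an increment of an empty register can then set its first bit.\<close>

fun bits :: "symbol \<Rightarrow> nat set" where
  "bits (Cell K B) = B"
| "bits _ = UNIV"

text \<open>In unary, column \<open>j\<close> shows whether \<open>j\<close> is less than the
  register. After \<open>Inc\<close> this is what column \<open>j - 1\<close> showed before (always
  true for \<open>j = 0\<close>), after \<open>Dec\<close> what column \<open>j + 1\<close>
  showed.\<close>

fun next_bits :: "com list \<Rightarrow> nat set \<Rightarrow> nat set \<Rightarrow> nat set \<Rightarrow> nat set" where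
  "next_bits (Clear i # K) L B R = B - {i}"
| "next_bits (Copy i j # K) L B R = (if j \<in> B then insert i B else B - {i})"
| "next_bits (Inc i # K) L B R = (if i \<in> L then insert i B else B - {i})"
| "next_bits (Dec i # K) L B R = (if i \<in> R then insert i B else B - {i})"
| "next_bits K L B R = B"

text \<open>The constraint on a symbol \<open>c\<close> with left, right and upper neighbours \<open>l\<close>, \<open>r\<close> and \<open>u\<close>. Each
  row of cells above a row \<open>Alpha Gamma1\<^sup>x Delta Gamma2\<^sup>y Beta Gamma3\<^sup>\<infinity>\<close> is a state of the
  machine: all its cells carry the code, and register \<open>i\<close> is the number of cells whose bit set
  contains \<open>i\<close>. Only the cell next to the wall can see which registers are zero; the code that it
  selects is propagated by the equality of codes along a row.\<close>

fun local_rule :: "com list \<Rightarrow> symbol \<Rightarrow> symbol \<Rightarrow> symbol \<Rightarrow> symbol \<Rightarrow> bool" where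
  "local_rule P l Blank r u \<longleftrightarrow> True"
| "local_rule P l Alpha r u \<longleftrightarrow> u = Wall \<and> (r = Gamma1 \<or> r = Delta)"
| "local_rule P l Gamma1 r u \<longleftrightarrow> u = Cell P {0, 1} \<and> (r = Gamma1 \<or> r = Delta)"
| "local_rule P l Delta r u \<longleftrightarrow> u = Cell P {1} \<and> (r = Gamma2 \<or> r = Beta)"
| "local_rule P l Gamma2 r u \<longleftrightarrow> u = Cell P {1} \<and> (r = Gamma2 \<or> r = Beta)"
| "local_rule P l Beta r u \<longleftrightarrow> u = Cell P {} \<and> r = Gamma3"
| "local_rule P l Gamma3 r u \<longleftrightarrow> u = Cell P {} \<and> r = Gamma3"
| "local_rule P l Wall r u \<longleftrightarrow> u = Wall"
| "local_rule P l (Cell K B) r u \<longleftrightarrow> K \<noteq> [] \<and> (\<exists>R K'. r = Cell K R \<and>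
    u = Cell K' (next_bits K (bits l) B R) \<and> (l = Wall \<longrightarrow> K' = next_code K (\<lambda>i. i \<in> B)))"

text \<open>The bound \<open>m\<close> on register indices leaves finitely many bit sets.\<close>

definition cell_bits :: "nat \<Rightarrow> (nat \<Rightarrow> nat) \<Rightarrow> nat \<Rightarrow> nat set" where
  "cell_bits m \<sigma> j = {i. i < m \<and> j < \<sigma> i}"

text \<open>The \<open>x\<close> cells above \<open>Gamma1\<close> carry bits 0 and 1, the
  \<open>y + 1\<close> cells above \<open>Delta\<close> and \<open>Gamma2\<close> only bit 1.
  Register 1 therefore starts with the sum and not with \<open>y\<close>.\<close>

definition init_regs :: "nat \<Rightarrow> nat \<Rightarrow> nat \<Rightarrow> nat" where
  "init_regs x y = (\<lambda>_. 0)(0 := x, 1 := Suc (x + y))"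

definition input_row :: "nat \<Rightarrow> nat \<Rightarrow> nat \<Rightarrow> symbol" where
  "input_row x y i = (if i = 0 then Alpha else if i \<le> x then Gamma1 else if i = Suc x then Delta
    else if i < x + y + 2 then Gamma2 else if i = x + y + 2 then Beta else Gamma3)"

lemma next_bits_correct:
  assumes "\<Union>(regs ` set K) \<subseteq> {..<m}"
  shows "next_bits K (if j = 0 then UNIV else cell_bits m \<sigma> (j - 1)) (cell_bits m \<sigma> j)
      (cell_bits m \<sigma> (Suc j)) = cell_bits m (next_regs K \<sigma>) j"
  using assms by (cases "(K, \<sigma>)" rule: next_regs.cases) (auto simp: cell_bits_def split: if_splits)

lemma next_code_correct:
  assumes "\<Union>(regs ` set K) \<subseteq> {..<m}"
  shows "next_code K (\<lambda>i. i \<in> cell_bits m \<sigma> 0) = next_code K (\<lambda>i. \<sigma> i > 0)"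
  using assms by (cases "(K, \<lambda>i. i \<in> cell_bits m \<sigma> 0)" rule: next_code.cases)
    (auto simp: cell_bits_def)

lemma regs_funpow_step: "\<Union>(regs ` set (fst ((step ^^ t) s))) \<subseteq> \<Union>(regs ` set (fst s))"
proof (induction t)
  case (Suc t)
  have "\<Union>(regs ` set (fst ((step ^^ Suc t) s))) \<subseteq> \<Union>(regs ` set (fst ((step ^^ t) s)))"
    unfolding funpow.simps(2) o_apply step_def fst_conv by (rule regs_next_code)
  with Suc show ?case by (rule order_trans[rotated])
qed simp

section \<open>Correspondence between tilings and infinite runs\<close>

locale machine =
  fixes P :: "com list" and m :: nat
  assumes regs_less: "\<Union>(regs ` set P) \<subseteq> {..<m}" and m_ge_2: "2 \<le> m"
begin

definition state :: "nat \<Rightarrow> nat \<Rightarrow> nat \<Rightarrow> com list \<times> (nat \<Rightarrow> nat)" where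
  "state x y t = (step ^^ t) (P, init_regs x y)"

definition state_cell :: "nat \<Rightarrow> nat \<Rightarrow> nat \<Rightarrow> nat \<Rightarrow> symbol" where
  "state_cell x y t j = Cell (fst (state x y t)) (cell_bits m (snd (state x y t)) j)"

lemma state_0: "state x y 0 = (P, init_regs x y)"
  and state_Suc: "state x y (Suc t) = step (state x y t)"
  by (simp_all add: state_def)

lemma regs_state: "\<Union>(regs ` set (fst (state x y t))) \<subseteq> {..<m}"
  using regs_funpow_step[of t "(P, init_regs x y)"] regs_less by (auto simp: state_def)

lemma local_rule_state_cell:
  assumes "fst (state x y t) \<noteq> []"
  shows "local_rule P (if j = 0 then Wall else state_cell x y t (j - 1)) (state_cell x y t j)
      (state_cell x y t (Suc j)) u \<longleftrightarrow>
    (\<exists>K'. u = Cell K' (cell_bits m (snd (state x y (Suc t))) j) \<and>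
      (j = 0 \<longrightarrow> K' = fst (state x y (Suc t))))"
proof -
  have "bits (if j = 0 then Wall else state_cell x y t (j - 1)) =
      (if j = 0 then UNIV else cell_bits m (snd (state x y t)) (j - 1))"
    by (simp add: state_cell_def)
  moreover have "(if j = 0 then Wall else state_cell x y t (j - 1)) = Wall \<longleftrightarrow> j = 0"
    by (simp add: state_cell_def)
  ultimately show ?thesis
    using assms next_bits_correct[OF regs_state, of x y t j "snd (state x y t)"]
      next_code_correct[OF regs_state, of x y t "snd (state x y t)"]
    by (auto simp: state_cell_def state_Suc step_def)
qed

lemma cell_above_input_row:
  assumes "local_rule P l (input_row x y (Suc j)) r u"
  shows "u = state_cell x y 0 j"
  using assms m_ge_2
  by (auto simp: input_row_def state_cell_def state_0 cell_bits_def init_regs_def split: if_splits)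

text \<open>The right-neighbour rules only move forward through \<open>Alpha\<close>,
  \<open>Gamma1\<close>, \<open>Delta\<close>, \<open>Gamma2\<close>, \<open>Beta\<close>,
  \<open>Gamma3\<close> and visit \<open>Delta\<close> and \<open>Beta\<close> at most once. Fixing
  one place of each leaves only the gap \<open>y\<close> between them open; without the
  \<open>Beta\<close>, \<open>Gamma2\<close> could continue forever.\<close>

lemma input_row_unique:
  assumes rule: "\<And>i. \<exists>l u. local_rule P l (f i) (f (Suc i)) u"
    and "f 0 = Alpha" "f (Suc x) = Delta" "f n = Beta"
  shows "\<exists>y. f = input_row x y"
proof -
  have late: "f (i + Suc j) \<in> {Gamma2, Beta, Gamma3}" if "f i \<in> {Delta, Gamma2, Beta, Gamma3}"
    for i j
  proof (induction j)
    case 0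
    then show ?case using that rule[of i] by auto
  next
    case (Suc j)
    then show ?case using rule[of "i + Suc j"] by auto
  qed
  have later: "f (i + Suc j) = Gamma3" if "f i \<in> {Beta, Gamma3}" for i j
  proof (induction j)
    case 0
    then show ?case using that rule[of i] by auto
  next
    case (Suc j)
    then show ?case using rule[of "i + Suc j"] by auto
  qed
  have before_Delta: "f i \<notin> {Delta, Gamma2, Beta, Gamma3}" if "i \<le> x" for i
    using late[of i "x - i"] assms(3) that by auto
  have G1: "f i = Gamma1" if "0 < i" "i \<le> x" for i
    using that
  proof (induction i)
    case (Suc i)
    then have "f i \<in> {Alpha, Gamma1}" using assms(2) by (cases i) auto
    with rule[of i] before_Delta[of "Suc i"] Suc.prems show ?case by auto
  qed simp
  have "Suc x < n"
  proof (rule ccontr)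
    assume "\<not> Suc x < n"
    then have "n \<le> x" using assms(3,4) by (cases "n = Suc x") auto
    then show False using before_Delta[of n] assms(4) by auto
  qed
  define y where "y = n - x - 2"
  with \<open>Suc x < n\<close> have n: "n = x + y + 2" by simp
  have before_Beta: "f i \<notin> {Beta, Gamma3}" if "i < n" for i
    using later[of i "n - Suc i"] assms(4) that by auto
  have G2: "f i = Gamma2" if "Suc x < i" "i < n" for i
    using that
  proof (induction i)
    case (Suc i)
    then have "f i \<in> {Delta, Gamma2}" using assms(3) by (cases "i = Suc x") auto
    with rule[of i] before_Beta[of "Suc i"] Suc.prems show ?case by auto
  qed simp
  have G3: "f i = Gamma3" if "n < i" for i
    using later[of n "i - Suc n"] assms(4) that by auto
  have "f i = input_row x y i" for i
  proof -
    consider "i = 0" | "0 < i" "i \<le> x" | "i = Suc x" | "Suc x < i" "i < n" | "i = n" | "n < i"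
      by linarith
    then show ?thesis
      by cases (use assms(2-4) n in \<open>simp_all add: input_row_def G1 G2 G3\<close>)
  qed
  then show ?thesis by blast
qed

text \<open>Row \<open>t + 1\<close> must be the state at time \<open>t\<close>, by induction on
  \<open>t\<close>. A cell with empty code violates the rule, so a complete quadrant excludes
  halting. The left neighbours of column 0 lie outside the quadrant and are arbitrary, since
  \<open>Alpha\<close> and \<open>Wall\<close> ignore them.\<close>

lemma quadrant_sound:
  assumes left: "\<And>t. \<exists>l. local_rule P l (f 0 t) (f 1 t) (f 0 (Suc t))"
    and rule: "\<And>i t. local_rule P (f i t) (f (Suc i) t) (f (Suc (Suc i)) t) (f (Suc i) (Suc t))"
    and row: "f 0 0 = Alpha" "f (Suc x) 0 = Delta" "f n 0 = Beta"
  shows "\<exists>y. \<forall>t. fst (state x y t) \<noteq> []"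
proof -
  have "\<exists>l u. local_rule P l (f i 0) (f (Suc i) 0) u" for i
    using left[of 0] rule[of "i - 1" 0] by (cases i) auto
  from input_row_unique[of "\<lambda>i. f i 0", OF this row]
  obtain y where y: "\<And>i. f i 0 = input_row x y i" by metis
  have wall: "f 0 (Suc t) = Wall" for t
  proof (induction t)
    case 0
    then show ?case using left[of 0] row(1) by auto
  next
    case (Suc t)
    then show ?case using left[of "Suc t"] by auto
  qed
  have rule': "local_rule P (if j = 0 then Wall else f j (Suc t)) (f (Suc j) (Suc t))
      (f (Suc (Suc j)) (Suc t)) (f (Suc j) (Suc (Suc t)))" for j t
    using rule[of j "Suc t"] wall by auto
  have cells: "\<forall>j. f (Suc j) (Suc t) = state_cell x y t j" for t
  proof (induction t)
    case 0
    show ?case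
    proof
      show "f (Suc j) (Suc 0) = state_cell x y 0 j" for j
        by (rule cell_above_input_row) (use rule[of j 0] in \<open>simp only: y\<close>)
    qed
  next
    case (Suc t)
    have ne: "fst (state x y t) \<noteq> []"
      using rule'[of 0 t] by (simp add: Suc state_cell_def)
    have u: "\<exists>K'. f (Suc j) (Suc (Suc t)) = Cell K' (cell_bits m (snd (state x y (Suc t))) j) \<and>
      (j = 0 \<longrightarrow> K' = fst (state x y (Suc t)))" for j
    proof -
      have "(if j = 0 then Wall else f j (Suc t)) = (if j = 0 then Wall else state_cell x y t (j - 1))"
        using Suc by (cases j) auto
      then show ?thesis
        using rule'[of j t] unfolding Suc[rule_format] local_rule_state_cell[OF ne, symmetric]
          by simp
    qed
    \<comment> \<open>So far the new code is known only in column 0. The rule applied within the new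
      row itself carries it to the right.\<close>
    have "f (Suc j) (Suc (Suc t)) = state_cell x y (Suc t) j" for j
    proof (induction j)
      case 0
      show ?case using u[of 0] by (auto simp: state_cell_def)
    next
      case (Suc j)
      then show ?case using u[of "Suc j"] rule[of j "Suc (Suc t)"] by (auto simp: state_cell_def)
    qed
    then show ?case ..
  qed
  have "fst (state x y t) \<noteq> []" for t
    using rule'[of 0 t] cells[of t] by (simp add: state_cell_def)
  then show ?thesis by blast
qed

text \<open>\<open>Blank\<close> puts no condition on its neighbours, so it can fill the other three
  quadrants.\<close>

definition diagram :: "nat \<Rightarrow> nat \<Rightarrow> int \<Rightarrow> int \<Rightarrow> symbol" where
  "diagram x y a b = (if a < 0 \<or> b < 0 then Blank else if b = 0 then input_row x y (nat a)
    else if a = 0 then Wall else state_cell x y (nat b - 1) (nat a - 1))"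

lemma diagram_sound:
  assumes "\<And>t. fst (state x y t) \<noteq> []"
  shows "local_rule P (diagram x y (a - 1) b) (diagram x y a b) (diagram x y (a + 1) b)
    (diagram x y a (b + 1))"
proof -
  consider "a < 0 \<or> b < 0" | "b = 0" "a \<ge> 0" | "b > 0" "a = 0" | "b > 0" "a > 0" by linarith
  then show ?thesis
  proof cases
    case 1
    then show ?thesis by (simp add: diagram_def)
  next
    case 2
    define i where "i = nat a"
    with 2 have a: "a = int i" by simp
    show ?thesis
    proof (cases i)
      case 0
      with 2 a show ?thesis by (auto simp: diagram_def input_row_def)
    next
      case (Suc j)
      have "diagram x y a (b + 1) = state_cell x y 0 j"
        "diagram x y a b = input_row x y (Suc j)"
          "diagram x y (a + 1) b = input_row x y (Suc (Suc j))"
        using 2 a Suc by (auto simp: diagram_def nat_add_distrib)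
      then show ?thesis
        using m_ge_2
        by (auto simp: input_row_def state_cell_def state_0 cell_bits_def init_regs_def)
    qed
  next
    case 3
    then show ?thesis by (simp add: diagram_def)
  next
    case 4
    define j t where "j = nat a - 1" and "t = nat b - 1"
    with 4 have a: "a = int (Suc j)" and b: "b = int (Suc t)" by auto
    have "diagram x y (a - 1) b = (if j = 0 then Wall else state_cell x y t (j - 1))"
      "diagram x y a b = state_cell x y t j" "diagram x y (a + 1) b = state_cell x y t (Suc j)"
      "diagram x y a (b + 1) = state_cell x y (Suc t) j"
      by (auto simp: diagram_def a b nat_add_distrib)
    then show ?thesis
      by (simp only: local_rule_state_cell[OF assms]) (simp add: state_cell_def)
  qed
qed

text \<open>With a single \<open>Alpha\<close>, the patterns that impose \<open>x\<close> need
  checking only at the corner.\<close>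

lemma diagram_Alpha: "diagram x y a b = Alpha \<longleftrightarrow> a = 0 \<and> b = 0"
  by (auto simp: diagram_def input_row_def state_cell_def split: if_splits)

lemma finite_diagram_symbols:
  "\<exists>S. finite S \<and> Alpha \<in> S \<and> Beta \<in> S \<and> Delta \<in> S \<and> (\<forall>x y a b. diagram x y a b \<in> S)"
proof -
  obtain T where T: "finite T" "P \<in> T" "\<And>K nonzero. K \<in> T \<Longrightarrow> next_code K nonzero \<in> T"
    using finite_continuations[of P] by blast
  have "fst (state x y t) \<in> T" for x y t
    by (induction t) (simp_all add: state_0 state_Suc step_def T)
  then have cell: "state_cell x y t j \<in> case_prod Cell ` (T \<times> Pow {..<m})" for x y t j
    by (auto simp: state_cell_def cell_bits_def)
  show ?thesis
  proof (intro exI[of _ "{Blank, Alpha, Gamma1, Delta, Gamma2, Beta, Gamma3, Wall} \<union>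
      case_prod Cell ` (T \<times> Pow {..<m})"] conjI allI)
    show "diagram x y a b \<in> {Blank, Alpha, Gamma1, Delta, Gamma2, Beta, Gamma3, Wall} \<union>
      case_prod Cell ` (T \<times> Pow {..<m})" for x y a b
      using cell by (simp add: diagram_def input_row_def)
  qed (simp_all add: T(1))
qed

end


section \<open>The subshift and the lower bound\<close>

lemma map_of_in_patterns:
  assumes "distinct (map fst ps)"
  shows "map_of ps \<in> patterns d A \<longleftrightarrow> (\<forall>(v, a)\<in>set ps. length v = d \<and> a \<in> A)"
proof -
  have "ran (map_of ps) = snd ` set ps" using assms by (rule ran_distinct)
  then show ?thesis
    unfolding patterns_def int_lattice_def mem_Collect_eq dom_map_of_conv_image_fst
    by (simp add: image_subset_iff split_beta ball_conj_distrib)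
qed

lemma appears_map_of:
  assumes "distinct (map fst ps)"
  shows "appears d (map_of ps) x \<longleftrightarrow> (\<exists>u\<in>int_lattice d. \<forall>(v, a)\<in>set ps. x (vadd u v) = a)"
proof -
  have "(\<forall>s\<in>dom (map_of ps). Some (x (vadd u s)) = map_of ps s) \<longleftrightarrow>
      (\<forall>(v, a)\<in>set ps. x (vadd u v) = a)" for u
    using assms map_of_is_SomeI[OF assms]
    by (fastforce simp: dom_map_of_conv_image_fst)
  then show ?thesis by (simp add: appears_def)
qed

lemma SFT_input_iff:
  "SFT_input d as pss \<longleftrightarrow>
    (\<forall>ps\<in>set pss. distinct (map fst ps) \<and> (\<forall>(v, a)\<in>set ps. length v = d \<and> a \<in> set as))"
  unfolding SFT_input_def by (intro ball_cong refl conj_cong map_of_in_patterns)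

lemma mem_SFT_of:
  assumes "SFT_input d as pss"
  shows "x \<in> SFT_of d as pss \<longleftrightarrow> x \<in> configurations d (set as) \<and>
    (\<forall>u\<in>int_lattice d. \<forall>ps\<in>set pss. \<exists>(v, a)\<in>set ps. x (vadd u v) \<noteq> a)"
proof -
  have "(\<forall>p\<in>map_of ` set pss. \<not> appears d p x) \<longleftrightarrow>
      (\<forall>ps\<in>set pss. \<forall>u\<in>int_lattice d. \<exists>(v, a)\<in>set ps. x (vadd u v) \<noteq> a)"
  proof -
    have "\<not> appears d (map_of ps) x \<longleftrightarrow> (\<forall>u\<in>int_lattice d. \<exists>(v, a)\<in>set ps. x (vadd u v) \<noteq> a)"
      if "ps \<in> set pss" for ps
    proof -
      have "distinct (map fst ps)" using assms that by (simp add: SFT_input_def)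
      then show ?thesis by (simp add: appears_map_of split_beta)
    qed
    then show ?thesis by simp
  qed
  then show ?thesis by (auto simp: SFT_of_def subshift_of_def)
qed

text \<open>The instances of \<open>enc\<close> follow the prescribed codes, so statements about
  \<open>computable\<close> concern the actual inputs of the problem.\<close>

lemma pattern_code_eq_enc: "pattern_code ps = enc ps"
  by (auto simp: pattern_code_def enc_list_def enc_prod_def enc_int_def enc_nat_def[abs_def]
      intro!: arg_cong[of _ _ list_encode])

lemma SFT_code_eq_enc: "SFT_code as pss = enc (as, pss)"
  by (simp add: SFT_code_def enc_Pair enc_list_def[of as] enc_list_def[of pss] enc_nat_def[abs_def]
      pattern_code_eq_enc[abs_def])

section \<open>The coordinate plane and the target subshift\<close>

definition point :: "nat \<Rightarrow> int \<Rightarrow> int \<Rightarrow> int list" where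
  "point d a b = a # b # replicate (d - 2) 0"

lemma length_point: "2 \<le> d \<Longrightarrow> length (point d a b) = d"
  by (simp add: point_def)

lemma point_in_lattice: "2 \<le> d \<Longrightarrow> point d a b \<in> int_lattice d"
  by (simp add: int_lattice_def length_point)

lemma vadd_point: "length w = d - 2 \<Longrightarrow> vadd (a # b # w) (point d i j) = (a + i) # (b + j) # w"
  by (auto simp: vadd_def point_def intro: nth_equalityI)

lemma lattice_cases:
  assumes "2 \<le> d" "v \<in> int_lattice d"
  obtains a b w where "v = a # b # w" "length w = d - 2"
  using assms by (cases v; cases "tl v") (auto simp: int_lattice_def)

lemma vadd_in_lattice: "u \<in> int_lattice d \<Longrightarrow> v \<in> int_lattice d \<Longrightarrow> vadd u v \<in> int_lattice d"
  by (simp add: int_lattice_def vadd_def)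

definition ordered_pair :: "nat \<Rightarrow> nat \<Rightarrow> nat \<Rightarrow> nat \<Rightarrow> pattern_list" where
  "ordered_pair d \<alpha> \<beta> n = [(point d 0 0, \<alpha>), (point d (int (Suc n)) 0, \<beta>)]"

definition separated :: "nat \<Rightarrow> nat \<Rightarrow> nat \<Rightarrow> nat \<Rightarrow> (int list \<Rightarrow> nat) set" where
  "separated d k \<alpha> \<beta> = subshift_of d {..<k} (range (\<lambda>n. map_of (ordered_pair d \<alpha> \<beta> n)))"

lemma distinct_ordered_pair: "distinct (map fst (ordered_pair d \<alpha> \<beta> n))"
  by (simp add: ordered_pair_def point_def)

lemma vadd_point_0:
  assumes "2 \<le> d" "u \<in> int_lattice d"
  shows "vadd u (point d 0 0) = u"
  using lattice_cases[OF assms] by (metis vadd_point add_0_right)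

lemma mem_separated:
  assumes "2 \<le> d"
  shows "x \<in> separated d k \<alpha> \<beta> \<longleftrightarrow> x \<in> configurations d {..<k} \<and>
    (\<forall>u\<in>int_lattice d. \<forall>n. \<not> (x u = \<alpha> \<and> x (vadd u (point d (int (Suc n)) 0)) = \<beta>))"
proof -
  have "appears d (map_of (ordered_pair d \<alpha> \<beta> n)) x \<longleftrightarrow>
      (\<exists>u\<in>int_lattice d. x u = \<alpha> \<and> x (vadd u (point d (int (Suc n)) 0)) = \<beta>)" for n
    unfolding appears_map_of[OF distinct_ordered_pair]
    by (simp add: ordered_pair_def vadd_point_0[OF assms] del: of_nat_Suc cong: bex_cong)
  then show ?thesis
    unfolding separated_def subshift_of_def by blast
qed

text \<open>\<open>pattern_codes\<close> contains a code for every order of the arguments. A pattern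
  on two points has exactly two, so each pair is enumerated together with its reversal.\<close>

lemma effective_separated:
  assumes "2 \<le> d" "\<alpha> < k" "\<beta> < k"
  shows "effective_subshift d (separated d k \<alpha> \<beta>)"
proof -
  let ?p = "ordered_pair d \<alpha> \<beta>"
  let ?F = "range (\<lambda>n. map_of (?p n))"
  have "?F \<subseteq> patterns d {..<k}"
    using assms map_of_in_patterns[OF distinct_ordered_pair]
    by (auto simp: ordered_pair_def length_point)
  moreover have "rec_enumerable (pattern_codes ?F)"
  proof -
    have iff: "distinct (map fst ps) \<and> map_of ps = map_of (?p n) \<longleftrightarrow> ps = ?p n \<or> ps = rev (?p n)"
      for ps n
    proof
      assume ps: "distinct (map fst ps) \<and> map_of ps = map_of (?p n)"
      then have "set ps = set (?p n)"
        using map_of_inject_set distinct_ordered_pair by blast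
      moreover have "distinct ps" using ps by (simp add: distinct_map)
      moreover have "distinct (?p n)" using distinct_ordered_pair by (simp add: distinct_map)
      ultimately have "set ps = set (?p n)" "distinct ps" "length ps = length (?p n)"
        using distinct_card[of ps] distinct_card[of "?p n"] by simp_all
      then have "length ps = 2" by (simp add: ordered_pair_def)
      then obtain a b where "ps = [a, b]" by (auto simp: length_Suc_conv numeral_2_eq_2)
      with \<open>set ps = set (?p n)\<close> \<open>distinct ps\<close> show "ps = ?p n \<or> ps = rev (?p n)"
        by (auto simp: ordered_pair_def doubleton_eq_iff)
    next
      assume "ps = ?p n \<or> ps = rev (?p n)"
      then show "distinct (map fst ps) \<and> map_of ps = map_of (?p n)"
        by (auto simp: ordered_pair_def point_def)
    qed
    have "pattern_codes ?F =
        {c. \<exists>n ps. c = enc ps \<and> distinct (map fst ps) \<and> map_of ps = map_of (?p n)}"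
      unfolding pattern_codes_def pattern_code_eq_enc by blast
    also have "\<dots> = {c. \<exists>n. c = enc (?p n) \<or> c = enc (rev (?p n))}"
      unfolding iff by blast
    also have "rec_enumerable \<dots>"
      by (rule rec_enumerable_exI, unfold ordered_pair_def point_def) (intro computable_intros)
    finally show ?thesis .
  qed
  ultimately show ?thesis
    unfolding effective_subshift_def separated_def by blast
qed

section \<open>Reduction from the universal relation\<close>

lemma separated_hard:
  assumes d: "2 \<le> d"
  shows "\<exists>k \<alpha> \<beta>. \<alpha> < k \<and> \<beta> < k \<and>
    many_one_reducible {x. \<forall>y. \<exists>z. universal x y z} (SFT_inclusion_problem d (separated d k \<alpha> \<beta>))"
proof -
  \<comment> \<open>Register 1 initially contains \<open>Suc (x + y)\<close>; subtracting
    \<open>Suc x\<close> recovers \<open>y\<close>.\<close>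
  have "computable (\<lambda>(x, y, z). universal x (y - Suc x) z)"
    by (intro computable_intros)
  then obtain P where P: "\<And>\<sigma>. (\<exists>n. fst ((step ^^ n) (P, \<sigma>)) = []) \<longleftrightarrow>
      (\<exists>z. universal (\<sigma> 0) (\<sigma> 1 - Suc (\<sigma> 0)) z)"
    using search_program_exists[of "\<lambda>x y z. universal x (y - Suc x) z"] by blast
  obtain m where m: "\<Union>(regs ` set P) \<subseteq> {..<m}" "2 \<le> m"
  proof -
    have "finite (\<Union>(regs ` set P) \<union> {1})" by (simp add: finite_regs)
    then obtain m where "\<Union>(regs ` set P) \<union> {1} \<subseteq> {..<m}"
      using finite_nat_set_iff_bounded by (auto simp: subset_eq)
    with that show ?thesis by auto
  qed
  interpret machine P m by standard (fact m)+
  have halts: "(\<exists>t. fst (state x y t) = []) \<longleftrightarrow> (\<exists>z. universal x y z)" for x y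
    using P[of "init_regs x y"] by (simp add: state_def init_regs_def)
  obtain S where S: "finite S" "Alpha \<in> S" "Beta \<in> S" "Delta \<in> S" "\<And>x y a b. diagram x y a b \<in> S"
    using finite_diagram_symbols by blast
  \<comment> \<open>The type \<open>symbol\<close> is infinite, so only the finitely many symbols of
    diagrams are numbered; \<open>g\<close> below turns letters back into symbols.\<close>
  obtain h where h: "bij_betw h S {0..<card S}" using ex_bij_betw_finite_nat[OF S(1)] by blast
  define k where "k = card S"
  define g where "g = inv_into S h"
  have h_less: "h s < k" if "s \<in> S" for s using h that by (auto simp: bij_betw_def k_def)
  have g_h: "g (h s) = s" if "s \<in> S" for s
    unfolding g_def using h that by (simp add: bij_betw_inv_into_left)
  have h_g: "h (g c) = c" if "c < k" for c
    unfolding g_def using h that by (simp add: bij_betw_inv_into_right k_def)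
  define \<alpha> \<beta> \<delta> where "\<alpha> = h Alpha" and "\<beta> = h Beta" and "\<delta> = h Delta"
  have less: "\<alpha> < k" "\<beta> < k" "\<delta> < k" by (simp_all add: \<alpha>_def \<beta>_def \<delta>_def h_less S)
  define nbhd :: "nat \<Rightarrow> nat \<Rightarrow> nat \<Rightarrow> nat \<Rightarrow> pattern_list" where
    "nbhd l c r u = [(point d (- 1) 0, l), (point d 0 0, c), (point d 1 0, r), (point d 0 1, u)]"
    for l c r u
  define L :: "pattern_list list" where
    "L = map (\<lambda>(l, c, r, u). nbhd l c r u)
      (filter (\<lambda>(l, c, r, u). \<not> local_rule P (g l) (g c) (g r) (g u))
        (List.product [0..<k] (List.product [0..<k] (List.product [0..<k] [0..<k]))))"
  \<comment> \<open>The only part of the SFT that depends on \<open>x\<close>; the alphabet and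
    \<open>L\<close> are constants of the reduction, which makes it computable.\<close>
  define X where "X x = map (\<lambda>c. [(point d 0 0, \<alpha>), (point d (int (Suc x)) 0, c)])
      (filter (\<lambda>c. c \<noteq> \<delta>) [0..<k])" for x
  have input: "SFT_input d [0..<k] (X x @ L)" for x
    using d less by (auto simp: SFT_input_iff X_def L_def nbhd_def length_point)
      (auto simp: point_def)
  have mem: "z \<in> SFT_of d [0..<k] (X x @ L) \<longleftrightarrow> z \<in> configurations d {..<k} \<and>
    (\<forall>u\<in>int_lattice d. (z u = \<alpha> \<longrightarrow> z (vadd u (point d (int (Suc x)) 0)) = \<delta>) \<and>
      local_rule P (g (z (vadd u (point d (- 1) 0)))) (g (z u)) (g (z (vadd u (point d 1 0))))
        (g (z (vadd u (point d 0 1)))))" (is "_ \<longleftrightarrow> ?conf \<and> (\<forall>u\<in>_. ?A u \<and> ?B u)") for z x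
  proof -
    have eq: "(\<forall>ps\<in>set (X x @ L). \<exists>(v, a)\<in>set ps. z (vadd u v) \<noteq> a) \<longleftrightarrow> ?A u \<and> ?B u"
      if "?conf" "u \<in> int_lattice d" for u
    proof -
      have z: "z v < k" if "v \<in> int_lattice d" for v
        using \<open>?conf\<close> that by (auto simp: configurations_def)
      have "(\<forall>ps\<in>set (X x). \<exists>(v, a)\<in>set ps. z (vadd u v) \<noteq> a) \<longleftrightarrow> ?A u"
        using z[of "vadd u (point d (int (Suc x)) 0)"] that(2) d
        by (auto simp: X_def vadd_point_0 vadd_in_lattice point_in_lattice simp del: of_nat_Suc)
      moreover have "(\<forall>ps\<in>set L. \<exists>(v, a)\<in>set ps. z (vadd u v) \<noteq> a) \<longleftrightarrow> ?B u"
      proof -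
        have "(\<forall>ps\<in>set L. \<exists>(v, a)\<in>set ps. z (vadd u v) \<noteq> a) \<longleftrightarrow>
          (\<forall>l<k. \<forall>c<k. \<forall>r<k. \<forall>t<k. \<not> local_rule P (g l) (g c) (g r) (g t) \<longrightarrow>
            z (vadd u (point d (- 1) 0)) \<noteq> l \<or> z u \<noteq> c \<or> z (vadd u (point d 1 0)) \<noteq> r \<or>
            z (vadd u (point d 0 1)) \<noteq> t)"
        proof -
          have "(\<exists>(v, a)\<in>set (nbhd l c r t). z (vadd u v) \<noteq> a) \<longleftrightarrow>
              z (vadd u (point d (- 1) 0)) \<noteq> l \<or> z u \<noteq> c \<or> z (vadd u (point d 1 0)) \<noteq> r \<or>
              z (vadd u (point d 0 1)) \<noteq> t" for l c r t
            by (simp add: nbhd_def vadd_point_0[OF d that(2)])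
          moreover have "(\<forall>ps\<in>set L. Q ps) \<longleftrightarrow> (\<forall>l<k. \<forall>c<k. \<forall>r<k. \<forall>t<k.
              \<not> local_rule P (g l) (g c) (g r) (g t) \<longrightarrow> Q (nbhd l c r t))" for Q
            by (auto simp: L_def)
          ultimately show ?thesis by simp
        qed
        moreover have "z (vadd u (point d i j)) < k" for i j
          using z d that(2) by (simp add: vadd_in_lattice point_in_lattice)
        ultimately show ?thesis using z[OF that(2)] by blast
      qed
      ultimately show ?thesis by (simp add: ball_Un)
    qed
    show ?thesis
      unfolding mem_SFT_of[OF input] set_upt lessThan_atLeast0[symmetric] using eq by auto
  qed
  have reduction: "(\<forall>y. \<exists>z. universal x y z) \<longleftrightarrow> SFT_of d [0..<k] (X x @ L) \<subseteq> separated d k \<alpha> \<beta>" for x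
  proof
    assume all: "\<forall>y. \<exists>z. universal x y z"
    show "SFT_of d [0..<k] (X x @ L) \<subseteq> separated d k \<alpha> \<beta>"
    proof
      fix z
      assume "z \<in> SFT_of d [0..<k] (X x @ L)"
      note z = this[unfolded mem]
      have "\<not> (z u = \<alpha> \<and> z (vadd u (point d (int (Suc n)) 0)) = \<beta>)" if u: "u \<in> int_lattice d"
        for u n
      proof
        assume marked: "z u = \<alpha> \<and> z (vadd u (point d (int (Suc n)) 0)) = \<beta>"
        \<comment> \<open>The quadrant with corner \<open>u\<close> in the plane through
          \<open>u\<close> spanned by the first two axes.\<close>
        define f where "f i t = g (z (vadd u (point d (int i) (int t))))" for i t
        obtain a b w where u_eq: "u = a # b # w" and w: "length w = d - 2"
          using lattice_cases[OF d u] by blast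
        have rule: "local_rule P (g (z (vadd u (point d (int i - 1) (int t))))) (f i t) (f (Suc i) t)
            (f i (Suc t))" for i t
        proof -
          have "vadd u (point d (int i) (int t)) \<in> int_lattice d"
            using u d by (simp add: vadd_in_lattice point_in_lattice)
          with z have "local_rule P
              (g (z (vadd (vadd u (point d (int i) (int t))) (point d (- 1) 0))))
              (g (z (vadd u (point d (int i) (int t)))))
              (g (z (vadd (vadd u (point d (int i) (int t))) (point d 1 0))))
              (g (z (vadd (vadd u (point d (int i) (int t))) (point d 0 1))))"
            by blast
          then show ?thesis by (simp add: f_def u_eq vadd_point w algebra_simps)
        qed
        have "\<exists>y. \<forall>t. fst (state x y t) \<noteq> []"
        proof (rule quadrant_sound[of f x "Suc n"])
          show "\<exists>l. local_rule P l (f 0 t) (f 1 t) (f 0 (Suc t))" for t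
            using rule[of 0 t] by auto
          show "local_rule P (f i t) (f (Suc i) t) (f (Suc (Suc i)) t) (f (Suc i) (Suc t))" for i t
            using rule[of "Suc i" t] by (simp add: f_def)
          show "f 0 0 = Alpha"
            using marked u d by (simp add: f_def vadd_point_0 \<alpha>_def g_h S)
          show "f (Suc x) 0 = Delta"
            using marked z u by (simp add: f_def \<delta>_def g_h S)
          show "f (Suc n) 0 = Beta"
            using marked by (simp add: f_def \<beta>_def g_h S)
        qed
        with all halts show False by blast
      qed
      with z show "z \<in> separated d k \<alpha> \<beta>" by (simp add: mem_separated[OF d])
    qed
  next
    assume sub: "SFT_of d [0..<k] (X x @ L) \<subseteq> separated d k \<alpha> \<beta>"
    show "\<forall>y. \<exists>z. universal x y z"
    proof (rule ccontr)
      assume "\<not> (\<forall>y. \<exists>z. universal x y z)"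
      then obtain y where y: "\<And>t. fst (state x y t) \<noteq> []" using halts by blast
      \<comment> \<open>The diagram in the first two coordinates, constant along all others.\<close>
      define z where "z = (\<lambda>v\<in>int_lattice d. h (diagram x y (hd v) (hd (tl v))))"
      have z: "z (a # b # w) = h (diagram x y a b)" if "length w = d - 2" for a b w
      proof -
        have "Suc (Suc (d - 2)) = d" using d by simp
        with that show ?thesis by (simp add: z_def int_lattice_def)
      qed
      have Alpha_iff: "h (diagram x y a b) = \<alpha> \<longleftrightarrow> a = 0 \<and> b = 0" for a b
        unfolding \<alpha>_def using diagram_Alpha[of x y a b] g_h S by metis
      have "z \<in> SFT_of d [0..<k] (X x @ L)"
        unfolding mem
      proof (intro conjI ballI)
        show "z \<in> configurations d {..<k}"
          by (auto simp: z_def configurations_def h_less S)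
      next
        fix u
        assume "u \<in> int_lattice d"
        then obtain a b w where u: "u = a # b # w" "length w = d - 2"
          using lattice_cases[OF d] by blast
        show "z u = \<alpha> \<longrightarrow> z (vadd u (point d (int (Suc x)) 0)) = \<delta>"
        proof
          assume "z u = \<alpha>"
          then have "a = 0" "b = 0" by (simp_all add: u z Alpha_iff)
          then show "z (vadd u (point d (int (Suc x)) 0)) = \<delta>"
            by (simp add: u z vadd_point \<delta>_def diagram_def input_row_def del: of_nat_Suc)
        qed
        show "local_rule P (g (z (vadd u (point d (- 1) 0)))) (g (z u)) (g (z (vadd u (point d 1 0))))
            (g (z (vadd u (point d 0 1))))"
          using diagram_sound[OF y, of a b] by (simp add: u z vadd_point g_h S)
      qed
      with sub have "z \<in> separated d k \<alpha> \<beta>" by blast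
      moreover have "z (point d 0 0) = \<alpha>"
        by (simp add: point_def z Alpha_iff)
      \<comment> \<open>\<open>Beta\<close> stands in column \<open>x + y + 2\<close>, so the
        violated pair of \<open>separated\<close> has index \<open>Suc (x + y)\<close>.\<close>
      moreover have "z (vadd (point d 0 0) (point d (int (Suc (Suc (x + y)))) 0)) = \<beta>"
        by (simp add: point_def[of d 0 0] vadd_point z)
          (simp add: diagram_def input_row_def \<beta>_def nat_add_distrib)
      ultimately show False
        using d by (auto simp: mem_separated point_in_lattice simp del: of_nat_Suc)
    qed
  qed
  have "x \<in> {x. \<forall>y. \<exists>z. universal x y z} \<longleftrightarrow>
      enc ([0..<k], X x @ L) \<in> SFT_inclusion_problem d (separated d k \<alpha> \<beta>)" for x
    using reduction[of x] input[of x] by (auto simp: SFT_inclusion_problem_def SFT_code_eq_enc)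
  moreover have "total_computable (\<lambda>x. enc ([0..<k], X x @ L))"
    unfolding total_computable_iff X_def point_def by (intro computable_intros)
  ultimately show ?thesis
    using less unfolding many_one_reducible_def by blast
qed


section \<open>The upper bound\<close>

lemma computable_distinct [computable_intros]:
  assumes "computable l"
  shows "computable (\<lambda>x. distinct (l x))"
proof -
  have "computable (\<lambda>x. \<forall>i<length (l x). hd (drop i (l x)) \<notin> set (drop (Suc i) (l x)))"
    by (intro computable_intros computable_comp[OF assms])
  moreover have "distinct xs \<longleftrightarrow> (\<forall>i<length xs. hd (drop i xs) \<notin> set (drop (Suc i) xs))"
    for xs :: "'b list"
    by (induction xs) (auto simp: All_less_Suc2)
  ultimately show ?thesis by simp
qed

text \<open>Koenig's lemma for a prefix-closed set of words over a finite alphabet: a word with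
  admissible extensions of every length has a one-letter extension of the same kind.\<close>

lemma infinite_branch:
  assumes "finite A" and closed: "\<And>u v. ok (u @ v) \<Longrightarrow> ok u"
    and ex: "\<And>n. \<exists>w. length w = n \<and> set w \<subseteq> A \<and> ok w"
  shows "\<exists>f. \<forall>n. f n \<in> A \<and> ok (map f [0..<n])"
proof -
  define good where "good w \<longleftrightarrow> (\<forall>n. \<exists>v. length v = n \<and> set (w @ v) \<subseteq> A \<and> ok (w @ v))" for w
  have extend: "\<exists>a. a \<in> A \<and> good (w @ [a])" if "good w" for w
  proof (rule ccontr)
    assume "\<nexists>a. a \<in> A \<and> good (w @ [a])"
    then obtain b where b: "\<And>a v. a \<in> A \<Longrightarrow> length v = b a \<Longrightarrow>
      \<not> (set (w @ [a] @ v) \<subseteq> A \<and> ok (w @ [a] @ v))"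
      unfolding good_def by (metis append_assoc)
    \<comment> \<open>One letter \<open>a\<close>, followed by at least as many letters as the
      length \<open>b a\<close> that fails for it; cutting the surplus contradicts the choice of
      \<open>b\<close>.\<close>
    obtain v where v: "length v = Suc (Max (b ` A))" "set (w @ v) \<subseteq> A" "ok (w @ v)"
      using \<open>good w\<close> unfolding good_def by blast
    then obtain a v' where v': "v = a # v'" "length v' = Max (b ` A)" by (cases v) auto
    have a: "a \<in> A" using v v' by auto
    then have "b a \<le> length v'" using v'(2) assms(1) by simp
    moreover have "w @ v = (w @ [a] @ take (b a) v') @ drop (b a) v'" by (simp add: v')
    then have "ok (w @ [a] @ take (b a) v')" using v(3) closed by metis
    moreover have "set (w @ [a] @ take (b a) v') \<subseteq> A"
      using v(2) v' set_take_subset[of "b a" v'] by auto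
    ultimately show False using b[OF a, of "take (b a) v'"] by simp
  qed
  define e where "e w = (SOME a. a \<in> A \<and> good (w @ [a]))" for w
  have e: "e w \<in> A \<and> good (w @ [e w])" if "good w" for w
    unfolding e_def by (rule someI_ex) (rule extend[OF that])
  define W where "W = rec_nat [] (\<lambda>_ w. w @ [e w])"
  have W: "W 0 = []" "W (Suc n) = W n @ [e (W n)]" for n
    by (simp_all add: W_def)
  have good: "good (W n)" for n
  proof (induction n)
    case 0
    show ?case using ex by (simp add: W good_def)
  next
    case (Suc n)
    then show ?case using e by (simp add: W)
  qed
  have "W n = map (\<lambda>i. e (W i)) [0..<n]" for n
    by (induction n) (simp_all add: W)
  moreover have "ok (W n)" for n
    using good[of n] unfolding good_def by (metis append_Nil2 length_0_conv)
  ultimately show ?thesis using e[OF good] by metis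
qed

text \<open>The word \<open>w\<close> is a partial configuration on the lattice points with code less than its length.\<close>

definition locally_admissible ::
  "nat \<Rightarrow> pattern_list list \<Rightarrow> pattern_list \<Rightarrow> nat list \<Rightarrow> bool" where
  "locally_admissible d pss ps w \<longleftrightarrow>
    (\<forall>(v, a)\<in>set ps. enc v < length w \<longrightarrow> hd (drop (enc v) w) = a) \<and>
    (\<forall>i<length w. length (inv enc i :: int list) = d \<longrightarrow>
      (\<forall>qs\<in>set pss. \<exists>(v, a)\<in>set qs. length w \<le> enc (vadd (inv enc i) v) \<or>
        hd (drop (enc (vadd (inv enc i) v)) w) \<noteq> a))"

lemma computable_locally_admissible:
  assumes "computable pss" "computable ps" "computable w"
  shows "computable (\<lambda>x. locally_admissible d (pss x) (ps x) (w x))"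
  unfolding locally_admissible_def
  by (intro computable_intros computable_inv_enc surj_enc_list surj_enc_int assms
      computable_comp[OF assms(1)] computable_comp[OF assms(2)] computable_comp[OF assms(3)])

lemma locally_admissible_nth:
  "locally_admissible d pss ps w \<longleftrightarrow>
    (\<forall>(v, a)\<in>set ps. enc v < length w \<longrightarrow> w ! enc v = a) \<and>
    (\<forall>u. enc u < length w \<longrightarrow> u \<in> int_lattice d \<longrightarrow>
      (\<forall>qs\<in>set pss. \<exists>(v, a)\<in>set qs. enc (vadd u v) < length w \<longrightarrow> w ! enc (vadd u v) \<noteq> a))"
proof -
  have 1: "(enc v < length w \<longrightarrow> hd (drop (enc v) w) = a) \<longleftrightarrow> (enc v < length w \<longrightarrow> w ! enc v = a)"
    for v :: "int list" and a by (auto simp: hd_drop_conv_nth)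
  have 2: "(length w \<le> enc v \<or> hd (drop (enc v) w) \<noteq> a) \<longleftrightarrow> (enc v < length w \<longrightarrow> w ! enc v \<noteq> a)"
    for v :: "int list" and a by (auto simp: hd_drop_conv_nth)
  have 3: "(\<forall>i<length w. length (inv enc i :: int list) = d \<longrightarrow> Q (inv enc i)) \<longleftrightarrow>
    (\<forall>u. enc u < length w \<longrightarrow> u \<in> int_lattice d \<longrightarrow> Q u)" (is "?L \<longleftrightarrow> ?R") for Q
  proof
    assume ?L
    then show ?R by (auto simp: int_lattice_def dest: spec[of _ "enc _"])
  next
    assume ?R
    then show ?L
      using surj_f_inv_f[OF surj_enc_list[OF surj_enc_int]] by (simp add: int_lattice_def)
  qed
  show ?thesis
    unfolding locally_admissible_def 1 2
    by (simp only: 3[of "\<lambda>u. \<forall>qs\<in>set pss. \<exists>(v, a)\<in>set qs.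
      enc (vadd u v) < length w \<longrightarrow> w ! enc (vadd u v) \<noteq> a"])
qed

text \<open>Lattice points are listed by their codes, so one infinite word is a configuration and
  its prefixes exhaust the lattice. A forbidden pattern that leaves the domain of a word counts as
  avoided; this makes admissibility prefix-closed, as \<open>infinite_branch\<close>
  requires.\<close>

lemma compactness:
  assumes input: "SFT_input d as pss" and ps: "\<forall>(v, a)\<in>set ps. v \<in> int_lattice d"
  shows "(\<exists>x\<in>SFT_of d as pss. \<forall>(v, a)\<in>set ps. x v = a) \<longleftrightarrow>
    (\<forall>n. \<exists>w\<in>set (List.n_lists n as). locally_admissible d pss ps w)"
proof
  assume "\<exists>x\<in>SFT_of d as pss. \<forall>(v, a)\<in>set ps. x v = a"
  then obtain x where "x \<in> SFT_of d as pss" "\<forall>(v, a)\<in>set ps. x v = a" by blast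
  then have x: "x \<in> configurations d (set as)"
    "\<And>u qs. u \<in> int_lattice d \<Longrightarrow> qs \<in> set pss \<Longrightarrow> \<exists>(v, a)\<in>set qs. x (vadd u v) \<noteq> a"
    "\<forall>(v, a)\<in>set ps. x v = a"
    unfolding mem_SFT_of[OF input] by blast+
  \<comment> \<open>A letter certain to lie in the alphabet; it fills the positions whose number
    codes no lattice point.\<close>
  let ?c = "x (replicate d 0)"
  have x_in: "x v \<in> set as" if "v \<in> int_lattice d" for v
    using x(1) that by (auto simp: configurations_def)
  have pss: "\<forall>(v, a)\<in>set qs. v \<in> int_lattice d" if "qs \<in> set pss" for qs
    using input that by (fastforce simp: SFT_input_iff int_lattice_def)
  show "\<forall>n. \<exists>w\<in>set (List.n_lists n as). locally_admissible d pss ps w"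
  proof
    fix n
    define w where "w = map (\<lambda>i. if inv enc i \<in> int_lattice d then x (inv enc i) else ?c) [0..<n]"
    have w_nth: "w ! enc v = x v" if "v \<in> int_lattice d" "enc v < n" for v
      using that by (simp add: w_def)
    have len: "length w = n" by (simp add: w_def)
    have "w \<in> set (List.n_lists n as)"
      using x_in by (auto simp: set_n_lists w_def int_lattice_def)
    moreover have "locally_admissible d pss ps w"
      unfolding locally_admissible_nth len
    proof (intro conjI allI impI ballI)
      fix u qs
      assume u: "u \<in> int_lattice d" and qs: "qs \<in> set pss"
      from x(2)[OF u qs] obtain v a where va: "(v, a) \<in> set qs" "x (vadd u v) \<noteq> a" by blast
      then have "vadd u v \<in> int_lattice d" using pss[OF qs] u by (auto intro: vadd_in_lattice)
      with va show "\<exists>(v, a)\<in>set qs. enc (vadd u v) < n \<longrightarrow> w ! enc (vadd u v) \<noteq> a"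
        by (intro bexI[OF _ va(1)]) (simp add: w_nth)
    qed (use x(3) ps w_nth in fastforce)
    ultimately show "\<exists>w\<in>set (List.n_lists n as). locally_admissible d pss ps w" by blast
  qed
next
  assume adm: "\<forall>n. \<exists>w\<in>set (List.n_lists n as). locally_admissible d pss ps w"
  have prefix: "locally_admissible d pss ps w" if *: "locally_admissible d pss ps (w @ w')" for w w'
    unfolding locally_admissible_nth
  proof (intro conjI allI impI ballI)
    fix u qs
    assume "enc u < length w" "u \<in> int_lattice d" "qs \<in> set pss"
    then have "\<exists>(v, a)\<in>set qs. enc (vadd u v) < length (w @ w') \<longrightarrow> (w @ w') ! enc (vadd u v) \<noteq> a"
      using *[unfolded locally_admissible_nth] by simp
    then show "\<exists>(v, a)\<in>set qs. enc (vadd u v) < length w \<longrightarrow> w ! enc (vadd u v) \<noteq> a"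
      by (elim bexE, intro bexI) (auto simp: nth_append)
  next
    have "\<forall>(v, a)\<in>set ps. enc v < length (w @ w') \<longrightarrow> (w @ w') ! enc v = a"
      using *[unfolded locally_admissible_nth] by (rule conjunct1)
    then show "case va of (v, a) \<Rightarrow> enc v < length w \<longrightarrow> w ! enc v = a" if "va \<in> set ps" for va
      using that by (auto simp: nth_append)
  qed
  have "\<exists>f. \<forall>n. f n \<in> set as \<and> locally_admissible d pss ps (map f [0..<n])"
    by (rule infinite_branch[OF _ prefix]) (use adm in \<open>auto simp: set_n_lists\<close>)
  then obtain f where f: "\<And>n. f n \<in> set as" "\<And>n. locally_admissible d pss ps (map f [0..<n])"
    by blast
  define x where "x = (\<lambda>v\<in>int_lattice d. f (enc v))"
  have pss: "\<forall>(v, a)\<in>set qs. v \<in> int_lattice d" if "qs \<in> set pss" for qs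
    using input that by (fastforce simp: SFT_input_iff int_lattice_def)
  have "x \<in> SFT_of d as pss"
    unfolding mem_SFT_of[OF input]
  proof (intro conjI ballI)
    show "x \<in> configurations d (set as)"
      using f(1) by (auto simp: x_def configurations_def)
    fix u qs
    assume u: "u \<in> int_lattice d" and qs: "qs \<in> set pss"
    \<comment> \<open>A prefix long enough to contain \<open>u\<close> and the whole translate of
      \<open>qs\<close>, so the mismatch it guarantees lies inside it.\<close>
    obtain n where n: "\<forall>i\<in>insert (enc u) ((\<lambda>(v, a). enc (vadd u v)) ` set qs). i < n"
      using finite_nat_set_iff_bounded[of "insert (enc u) ((\<lambda>(v, a). enc (vadd u v)) ` set qs)"]
        by auto
    have "\<exists>(v, a)\<in>set qs. enc (vadd u v) < n \<longrightarrow> map f [0..<n] ! enc (vadd u v) \<noteq> a"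
      using f(2)[of n, unfolded locally_admissible_nth] n u qs by simp
    then obtain v a where va: "(v, a) \<in> set qs" "enc (vadd u v) < n \<longrightarrow> f (enc (vadd u v)) \<noteq> a"
      by auto
    moreover have "enc (vadd u v) < n" using n va(1) by fastforce
    moreover have "vadd u v \<in> int_lattice d" using pss[OF qs] va(1) u
      by (auto intro: vadd_in_lattice)
    ultimately show "\<exists>(v, a)\<in>set qs. x (vadd u v) \<noteq> a"
      by (intro bexI[of _ "(v, a)"]) (auto simp: x_def)
  qed
  moreover have "x v = a" if "(v, a) \<in> set ps" for v a
  proof -
    have "\<forall>(v', b)\<in>set ps. enc v' < Suc (enc v) \<longrightarrow> map f [0..<Suc (enc v)] ! enc v' = b"
      using f(2)[of "Suc (enc v)", unfolded locally_admissible_nth length_map length_upt diff_zero]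
      by (rule conjunct1)
    from bspec[OF this that] have "map f [0..<Suc (enc v)] ! enc v = a" by simp
    then have "f (enc v) = a" by (simp del: upt_Suc)
    moreover have "v \<in> int_lattice d" using that ps by blast
    ultimately show ?thesis by (simp add: x_def)
  qed
  ultimately show "\<exists>x\<in>SFT_of d as pss. \<forall>(v, a)\<in>set ps. x v = a" by blast
qed

text \<open>Inclusion can fail in two ways, and \<open>a\<close> selects between them: a forbidden
  pair, or a letter \<open>a\<close> outside the alphabet \<open>{..<k}\<close>, which the input may
  well use.\<close>

definition violation :: "nat \<Rightarrow> nat \<Rightarrow> nat \<Rightarrow> nat \<Rightarrow> int list \<Rightarrow> nat \<Rightarrow> nat \<Rightarrow> pattern_list" where
  "violation d k \<alpha> \<beta> u n a =
    (if a < k then [(u, \<alpha>), (vadd u (point d (int (Suc n)) 0), \<beta>)] else [(u, a)])"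

lemma SFT_subset_separated_iff:
  assumes d: "2 \<le> d" and k: "0 < k" and input: "SFT_input d as pss"
  shows "SFT_of d as pss \<subseteq> separated d k \<alpha> \<beta> \<longleftrightarrow> (\<forall>u\<in>int_lattice d. \<forall>n a.
    \<not> (\<exists>x\<in>SFT_of d as pss. \<forall>(v, b)\<in>set (violation d k \<alpha> \<beta> u n a). x v = b))" (is "_ \<longleftrightarrow> ?R")
proof
  assume sub: "SFT_of d as pss \<subseteq> separated d k \<alpha> \<beta>"
  show ?R
  proof (intro ballI allI notI)
    fix u n a
    assume u: "u \<in> int_lattice d"
      and "\<exists>x\<in>SFT_of d as pss. \<forall>(v, b)\<in>set (violation d k \<alpha> \<beta> u n a). x v = b"
    then obtain x where "x \<in> separated d k \<alpha> \<beta>" "\<forall>(v, b)\<in>set (violation d k \<alpha> \<beta> u n a). x v = b"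
      using sub by blast
    with u show False
      unfolding mem_separated[OF d]
      by (auto simp: violation_def configurations_def simp del: of_nat_Suc split: if_splits)
  qed
next
  assume R: ?R
  show "SFT_of d as pss \<subseteq> separated d k \<alpha> \<beta>"
  proof
    fix x
    assume x: "x \<in> SFT_of d as pss"
    have "x v < k" if "v \<in> int_lattice d" for v
    proof (rule ccontr)
      assume "\<not> x v < k"
      then have "\<forall>(v', b)\<in>set (violation d k \<alpha> \<beta> v 0 (x v)). x v' = b"
        by (simp add: violation_def)
      with R that x show False by blast
    qed
    then have "x \<in> configurations d {..<k}"
      using x by (auto simp: mem_SFT_of[OF input] configurations_def)
    moreover have "\<not> (x u = \<alpha> \<and> x (vadd u (point d (int (Suc n)) 0)) = \<beta>)"
      if "u \<in> int_lattice d" for u n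
      \<comment> \<open>The value 0 for \<open>a\<close> selects the forbidden pair, because
        \<open>0 < k\<close>.\<close>
      using R[rule_format, OF that, of n 0] x k by (auto simp: violation_def simp del: of_nat_Suc)
    ultimately show "x \<in> separated d k \<alpha> \<beta>" by (simp add: mem_separated[OF d])
  qed
qed

lemma computable_violation [computable_intros]:
  assumes "computable u" "computable n" "computable a"
  shows "computable (\<lambda>x. violation d k \<alpha> \<beta> (u x) (n x) (a x))"
  unfolding violation_def point_def by (intro computable_intros assms)

lemma computable_SFT_input [computable_intros]:
  assumes "computable as" "computable pss"
  shows "computable (\<lambda>x. SFT_input d (as x) (pss x))"
  unfolding SFT_input_iff by (intro computable_intros computable_comp[OF assms(1)] assms(2))

lemma Pi02_inclusion:
  assumes d: "2 \<le> d" and k: "0 < k"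
  shows "Pi02 (SFT_inclusion_problem d (separated d k \<alpha> \<beta>))"
proof -
  \<comment> \<open>\<open>y\<close> codes a possible violation, and \<open>n\<close> is a word
    length at which no admissible word is compatible with it. Ill-formed inputs fail for every
    \<open>n\<close>; for well-formed ones, a \<open>y\<close> whose vector has the wrong length is
    satisfied trivially.\<close>
  define R where "R c y n \<longleftrightarrow>
    (let q = inv enc c :: nat list \<times> pattern_list list; t = inv enc y :: int list \<times> nat \<times> nat in
      SFT_input d (fst q) (snd q) \<and>
      (length (fst t) = d \<longrightarrow> (\<forall>w\<in>set (List.n_lists n (fst q)). \<not> locally_admissible d (snd q)
        (violation d k \<alpha> \<beta> (fst t) (fst (snd t)) (snd (snd t))) w)))" for c y n
  have "decidable3 R"
      unfolding R_def Let_def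
    by (intro decidable3I computable_intros computable_locally_admissible computable_inv_enc
        surj_enc_prod surj_enc_list surj_enc_int surj_enc_nat)
  moreover have "SFT_inclusion_problem d (separated d k \<alpha> \<beta>) = {c. \<forall>y. \<exists>n. R c y n}"
  proof -
    have "enc (as, pss) \<in> SFT_inclusion_problem d (separated d k \<alpha> \<beta>) \<longleftrightarrow>
        (\<forall>y. \<exists>n. R (enc (as, pss)) y n)" for as :: "nat list" and pss :: "pattern_list list"
    proof -
      let ?viol = "violation d k \<alpha> \<beta>"
      have surj: "(\<forall>y. Q (inv enc y)) \<longleftrightarrow> (\<forall>u n a. Q (u :: int list, n :: nat, a :: nat))" for Q
        by (metis inv_enc_enc prod.exhaust_sel)
      have "(\<forall>y. \<exists>n. R (enc (as, pss)) y n) \<longleftrightarrow> SFT_input d as pss \<and> (\<forall>u\<in>int_lattice d. \<forall>i a.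
          \<not> (\<forall>n. \<exists>w\<in>set (List.n_lists n as). locally_admissible d pss (?viol u i a) w))"
        unfolding R_def Let_def inv_enc_enc fst_conv snd_conv
        by (subst surj) (auto simp: int_lattice_def)
      also have "\<dots> \<longleftrightarrow> SFT_input d as pss \<and> SFT_of d as pss \<subseteq> separated d k \<alpha> \<beta>"
      proof (rule conj_cong[OF refl])
        assume input: "SFT_input d as pss"
        have "\<forall>(v, b)\<in>set (?viol u i a). v \<in> int_lattice d" if "u \<in> int_lattice d" for u i a
          using that d by (auto simp: violation_def vadd_in_lattice point_in_lattice)
        then show "(\<forall>u\<in>int_lattice d. \<forall>i a. \<not> (\<forall>n. \<exists>w\<in>set (List.n_lists n as).
            locally_admissible d pss (?viol u i a) w)) \<longleftrightarrow> SFT_of d as pss \<subseteq> separated d k \<alpha> \<beta>"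
          unfolding SFT_subset_separated_iff[OF d k input] using compactness[OF input] by simp
      qed
      also have "\<dots> \<longleftrightarrow> enc (as, pss) \<in> SFT_inclusion_problem d (separated d k \<alpha> \<beta>)"
        by (auto simp: SFT_inclusion_problem_def SFT_code_eq_enc)
      finally show ?thesis ..
    qed
    \<comment> \<open>Every number codes some pair of lists, possibly an ill-formed input, so the
      preceding equivalence covers all numbers.\<close>
    moreover have "\<exists>(as :: nat list) (pss :: pattern_list list). c = enc (as, pss)" for c
    proof -
      have "surj (enc :: nat list \<times> pattern_list list \<Rightarrow> nat)"
        by (intro surj_enc_prod surj_enc_list surj_enc_int surj_enc_nat)
      then obtain p :: "nat list \<times> pattern_list list" where "c = enc p" by (rule surjE)
      then show ?thesis by (cases p) auto
    qed
    ultimately have "c \<in> SFT_inclusion_problem d (separated d k \<alpha> \<beta>) \<longleftrightarrow> (\<forall>y. \<exists>n. R c y n)" for c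
      by metis
    then show ?thesis by blast
  qed
  ultimately show ?thesis unfolding Pi02_def by blast
qed

lemma many_one_reducible_trans:
  assumes "many_one_reducible A B" "many_one_reducible B C"
  shows "many_one_reducible A C"
  using assms computable_comp unfolding many_one_reducible_def total_computable_iff by metis

theorem theorem6p3:
  fixes d :: nat
  assumes "d \<ge> 2"
  shows "\<exists>Y. effective_subshift d Y \<and> Pi02_complete (SFT_inclusion_problem d Y)"
proof -
  obtain k \<alpha> \<beta> where k: "\<alpha> < k" "\<beta> < k"
    and hard: "many_one_reducible {x. \<forall>y. \<exists>z. universal x y z} (SFT_inclusion_problem d (separated d k \<alpha> \<beta>))"
    using separated_hard[OF assms] by blast
  have "Pi02_complete (SFT_inclusion_problem d (separated d k \<alpha> \<beta>))"
    unfolding Pi02_complete_def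
    using Pi02_inclusion[OF assms, of k] k many_one_reducible_trans[OF Pi02_reduces_to_universal hard]
    by auto
  with effective_separated[OF assms k] show ?thesis by blast
qed

end
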